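(* Let $\Pi$ be an arbitrary datalog program, and let $\Pi'$ be the EDB-adorned program obtained from $\Pi$ by the adornment algorithm (described in the context) with adornment relaxation function $g_{\mathsf{out}}$ and membership checking function $h_{\mathsf{eq}}$. Then $\Pi'$ is an EDB-bounded program equivalent to $\Pi$. That is: (i) every rule of $\Pi'$ is bounded by the adornment of its head predicate, and (ii) for every EDB instance $D$ and every IDB predicate $q$ occurring in $\Pi$, $[\![q(\Pi,D)]\!]=\bigcup_{\rho}[\![q_\rho(\Pi',D)]\!]$, the union ranging over all adornments $\rho$ such that $q_\rho$ occurs in $\Pi'$.
   Context: Datalog. Standard positive datalog programs: finite sets of rules $q(\bar s)\gets p_1(\bar s_1),\dots,p_\mu(\bar s_\mu)$ whose terms are variables or constants. A predicate is IDB if it is the head predicate of a rule with non-empty body, otherwise EDB. A rule is safe if every head variable occurs in the body. "$\_$" denotes a fresh existentially quantified variable (each occurrence distinct). $[\![q(\Pi,D)]\!]$ is the set of tuples $\bar s$ such that $q(\bar s)$ is in the least fixpoint of $\Pi$ on the EDB instance $D$. A ground atom $q(\bar t)$ is derived by rule $R$ over $D$ if it has a proof tree whose topmost rule application uses $R$. Adornments. An EDB-adorned atom is $q_\rho(\bar t)$, with $q$ an IDB predicate and $\rho$ (the adornment) a safe datalog rule whose head atom $A$ has predicate $q$, whose body atoms all have EDB predicates with arguments being variables or $\_$, and such that $q(\bar t)$ is an instance of $A$. Here $q_\rho$ is treated as a new predicate. An EDB-adorned rule/program is one in which every atom is an EDB atom or an EDB-adorned IDB atom. A rule $R$ with head predicate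 $q_\rho$ in an EDB-adorned program $\Pi'$ is bounded by $\rho$ if for every EDB $D$: whenever $q_\rho(\bar t)$ is derived by $R$ when evaluating $\Pi'$ over $D$, then $q(\bar t)$ is derived by evaluating the single-rule program $\{\rho\}$ over $D$. An EDB-adorned program is EDB-bounded if each of its rules is bounded by the adornment of its head predicate. Adornment algorithm (parameters $g$, $h$). Start with $\Pi'=\emptyset$. Repeat until a fixpoint for $\Pi'$: for each rule $R: q(\bar s)\gets \bigwedge_{i=1}^{\lambda}p_i(\bar s_i)\wedge\mathcal E$ of $\Pi$ ($p_i$ IDB predicates, $\mathcal E$ a conjunction of EDB atoms, $\lambda\ge 0$), and for each choice $(\rho_1,\dots,\rho_\lambda)$ such that for each $i$ some rule of $\Pi'$ has head atom ${p_i}_{\rho_i}(\bar v_i)$: rename variables in these head atoms together with their adornments, obtaining ${p_i}_{\rho_i'}(\bar v_i')$, so that $R$ and all these head atoms are variable-disjoint; write $\rho_i'$ as $p_i(\bar v_i')\gets\mathcal B_i$; let $\sigma$ be a simultaneous most general unifier of $\{(\bar s_i,\bar v_i')\mid 1\le i\le\lambda\}$ (if none exists, skip this choice); let $\rho_0$ be the rule $q(\sigma(\bar s))\gets\bigwedge_{i}\sigma(\mathcal B_i)\wedge\sigma(\mathcal E)$, let $\rho=g(\rho_0)$, and let $R'$ be $q_\rho(\sigma(\bar s))\gets\bigwedge_i {p_i}_{\rho_i}(\sigma(\bar s_i))\wedge\sigma(\mathcal E)$; if $h(R',\Pi')$ is false, add $R'$ to $\Pi'$. Output $\Pi'$. $g_{\mathsf{out}}$: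 in each body atom, replace every argument that does not occur in the rule head by $\_$; then remove every body atom $e(\bar t)$ for which there is another body atom $e(\bar t')$ such that for each position $i$ either $t_i=t_i'$ or $t_i=\_$ (of identical atoms one is kept); in particular, atoms with only $\_$ arguments are removed. $h_{\mathsf{eq}}(R',\Pi')$ is true iff $\Pi'$ contains a rule identical to $R'$ up to variable renaming.
   Formalization: Body-free rules of Π with an EDB head predicate count as data: D must contain their facts and the algorithm skips them; adornment bodies may contain constants kept by g_out; that Π' is EDB-adorned (safe adornments) is claimed only when all rules of Π are safe. *)

theory Defs
  imports Main
begin

section \<open>Datalog\<close>

datatype 'c trm = Var nat | Const 'c

datatype ('p, 't) atom = Atom (pred: 'p) (args: "'t list")

text \<open>The argument types of head and body are separate parameters, since the anonymous variable
  \<open>_\<close> may occur in rule bodies only. In a \<open>wrule\<close>, the body argument \<^term>\<open>None\<close> stands for \<open>_\<close>.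
  Predicates may be used with several arities; atoms of different arity never unify.\<close>

datatype ('p, 't, 'u) rule = Rule (head: "('p, 't) atom") (body: "('p, 'u) atom list")

type_synonym ('p, 'c) drule = "('p, 'c trm, 'c trm) rule"
type_synonym ('p, 'c) wrule = "('p, 'c trm, 'c trm option) rule"

definition lift_rule :: "('p, 'c) drule \<Rightarrow> ('p, 'c) wrule" where
  "lift_rule = map_rule id id Some"

fun tval :: "(nat \<Rightarrow> 'c) \<Rightarrow> 'c trm \<Rightarrow> 'c" where
  "tval \<nu> (Var x) = \<nu> x"
| "tval \<nu> (Const c) = c"

definition ground :: "(nat \<Rightarrow> 'c) \<Rightarrow> ('p, 'c trm) atom \<Rightarrow> ('p, 'c) atom" where
  "ground \<nu> = map_atom id (tval \<nu>)"

text \<open>Each occurrence of \<open>_\<close> is a separate existentially quantified variable, so it matches every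
  constant, independently of the other occurrences.\<close>

definition matches :: "(nat \<Rightarrow> 'c) \<Rightarrow> ('p, 'c trm option) atom \<Rightarrow> ('p, 'c) atom \<Rightarrow> bool" where
  "matches \<nu> b a \<longleftrightarrow> pred a = pred b \<and>
     list_all2 (\<lambda>t c. case t of None \<Rightarrow> True | Some t' \<Rightarrow> tval \<nu> t' = c) (args b) (args a)"

inductive_set model :: "('p, 'c) wrule set \<Rightarrow> ('p, 'c) atom set \<Rightarrow> ('p, 'c) atom set"
  for P :: "('p, 'c) wrule set" and D :: "('p, 'c) atom set" where
  edb: "a \<in> D \<Longrightarrow> a \<in> model P D"
| rule: "\<lbrakk>R \<in> P; list_all2 (matches \<nu>) (body R) as; \<forall>a\<in>set as. a \<in> model P D\<rbrakk>
    \<Longrightarrow> ground \<nu> (head R) \<in> model P D"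

definition answers :: "('p, 'c) drule set \<Rightarrow> ('p, 'c) atom set \<Rightarrow> 'p \<Rightarrow> 'c list set" where
  "answers P D q = {ts. Atom q ts \<in> model (lift_rule ` P) D}"

text \<open>The ground atoms that have a proof tree over \<open>D\<close> whose topmost rule application uses \<open>R\<close>
  (for \<open>R \<in> P\<close>).\<close>

definition derived_by :: "('p, 'c) drule \<Rightarrow> ('p, 'c) drule set \<Rightarrow> ('p, 'c) atom set
    \<Rightarrow> ('p, 'c) atom set" where
  "derived_by R P D = {ground \<nu> (head R) | \<nu> as.
     list_all2 (matches \<nu>) (body (lift_rule R)) as \<and> set as \<subseteq> model (lift_rule ` P) D}"

definition idb :: "('p, 'c) drule set \<Rightarrow> 'p \<Rightarrow> bool" where
  "idb P q \<longleftrightarrow> (\<exists>R\<in>P. pred (head R) = q \<and> body R \<noteq> [])"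

text \<open>A predicate that occurs in heads of body-free rules only is EDB. Such body-free rules of a
  program are EDB data, and hence part of every EDB instance of the program. If all rule heads of
  \<open>P\<close> have IDB predicates, the second condition is void.\<close>

definition edb_instance :: "('p, 'c) drule set \<Rightarrow> ('p, 'c) atom set \<Rightarrow> bool" where
  "edb_instance P D \<longleftrightarrow> (\<forall>a\<in>D. \<not> idb P (pred a)) \<and>
     (\<forall>R\<in>P. \<not> idb P (pred (head R)) \<longrightarrow> (\<forall>\<nu>. ground \<nu> (head R) \<in> D))"

definition safe :: "('p, 'c) wrule \<Rightarrow> bool" where
  "safe R \<longleftrightarrow> (\<forall>x. Var x \<in> set (args (head R)) \<longrightarrow>
     (\<exists>b\<in>set (body R). Some (Var x) \<in> set (args b)))"

definition rule_vars :: "('p, 'c) wrule \<Rightarrow> nat set" where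
  "rule_vars R = {x. Var x \<in> set (args (head R)) \<or>
     (\<exists>b\<in>set (body R). Some (Var x) \<in> set (args b))}"

section \<open>Substitutions\<close>

fun subst :: "(nat \<Rightarrow> 'c trm) \<Rightarrow> 'c trm \<Rightarrow> 'c trm" where
  "subst \<sigma> (Var x) = \<sigma> x"
| "subst \<sigma> (Const c) = Const c"

definition unifier :: "(nat \<Rightarrow> 'c trm) \<Rightarrow> ('c trm list \<times> 'c trm list) list \<Rightarrow> bool" where
  "unifier \<sigma> eqs \<longleftrightarrow> (\<forall>(s, t)\<in>set eqs. map (subst \<sigma>) s = map (subst \<sigma>) t)"

definition mgu :: "(nat \<Rightarrow> 'c trm) \<Rightarrow> ('c trm list \<times> 'c trm list) list \<Rightarrow> bool" where
  "mgu \<sigma> eqs \<longleftrightarrow> unifier \<sigma> eqs \<and>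
     (\<forall>\<theta>. unifier \<theta> eqs \<longrightarrow> (\<exists>\<tau>. \<forall>x. \<theta> x = subst \<tau> (\<sigma> x)))"

definition rename :: "(nat \<Rightarrow> nat) \<Rightarrow> ('p, 'c) wrule \<Rightarrow> ('p, 'c) wrule" where
  "rename \<pi> = map_rule id (subst (Var \<circ> \<pi>)) (map_option (subst (Var \<circ> \<pi>)))"

text \<open>Since rules have finitely many variables, every injective renaming of the variables of a rule
  extends to a permutation of all variables.\<close>

definition variant :: "('p, 'c) wrule \<Rightarrow> ('p, 'c) wrule \<Rightarrow> bool" where
  "variant R R' \<longleftrightarrow> (\<exists>\<pi>. bij \<pi> \<and> R' = rename \<pi> R)"

lemma subst_Var: "subst Var = id"
proof
  fix t :: "'c trm"
  show "subst Var t = id t" by (cases t) auto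
qed

lemma subst_rename_comp: "subst (Var \<circ> \<pi>) \<circ> subst (Var \<circ> \<pi>') = subst (Var \<circ> (\<pi> \<circ> \<pi>'))"
proof
  fix t :: "'c trm"
  show "(subst (Var \<circ> \<pi>) \<circ> subst (Var \<circ> \<pi>')) t = subst (Var \<circ> (\<pi> \<circ> \<pi>')) t" by (cases t) auto
qed

lemma rename_id: "rename id R = R"
  by (simp add: rename_def subst_Var option.map_id0 rule.map_id)

lemma rename_rename: "rename \<pi> (rename \<pi>' R) = rename (\<pi> \<circ> \<pi>') R"
proof -
  have "map_option (subst (Var \<circ> \<pi>)) \<circ> map_option (subst (Var \<circ> \<pi>'))
      = (map_option (subst (Var \<circ> (\<pi> \<circ> \<pi>'))) :: 'b trm option \<Rightarrow> _)"
    by (simp add: fun_eq_iff option.map_comp subst_rename_comp)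
  then show ?thesis
    by (simp add: rename_def rule.map_comp subst_rename_comp)
qed

lemma equivp_variant: "equivp (variant :: ('p, 'c) wrule \<Rightarrow> _)"
proof (rule equivpI)
  show "reflp (variant :: ('p, 'c) wrule \<Rightarrow> _)"
    by (rule reflpI) (metis variant_def rename_id bij_id)
  show "symp (variant :: ('p, 'c) wrule \<Rightarrow> _)"
  proof (rule sympI)
    fix R R' :: "('p, 'c) wrule"
    assume "variant R R'"
    then obtain \<pi> where \<pi>: "bij \<pi>" "R' = rename \<pi> R" by (auto simp: variant_def)
    then have "R = rename (inv \<pi>) R'"
      by (simp add: rename_rename rename_id bij_is_inj)
    with \<pi> show "variant R' R" by (auto simp: variant_def intro: bij_imp_bij_inv)
  qed
  show "transp (variant :: ('p, 'c) wrule \<Rightarrow> _)"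
    by (rule transpI) (metis variant_def rename_rename bij_comp)
qed

section \<open>Adornments\<close>

text \<open>Adornments that are equal up to variable renaming give the same predicate: the variables of
  \<open>\<rho>\<close> in \<open>q\<^sub>\<rho>\<close> are local to \<open>\<rho>\<close>. Body arguments of adornments may also be constants, as \<open>g_out\<close>
  keeps constants that occur in the head.\<close>

quotient_type ('p, 'c) adornment = "('p, 'c trm, 'c trm option) rule" / variant
  by (rule equivp_variant)

text \<open>\<open>Adorned [\<rho>]\<close> is \<open>q\<^sub>\<rho>\<close>, where \<open>q\<close> is the head predicate of \<open>\<rho>\<close>.\<close>

datatype ('p, 'c) apred = Edb 'p | Adorned "('p, 'c) adornment"

type_synonym ('p, 'c) arule = "(('p, 'c) apred, 'c) drule"

definition adorned :: "('p, 'c) wrule \<Rightarrow> ('p, 'c) apred" where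
  "adorned \<rho> = Adorned (abs_adornment \<rho>)"

definition edb_embed :: "('p, 'c) atom set \<Rightarrow> (('p, 'c) apred, 'c) atom set" where
  "edb_embed D = map_atom Edb id ` D"

definition edb_adorned_atom :: "('p, 'c) drule set \<Rightarrow> (('p, 'c) apred, 'c trm) atom \<Rightarrow> bool" where
  "edb_adorned_atom P a \<longleftrightarrow> (\<exists>\<rho>. pred a = adorned \<rho> \<and> idb P (pred (head \<rho>)) \<and> safe \<rho> \<and>
     (\<forall>b\<in>set (body \<rho>). \<not> idb P (pred b)) \<and>
     (\<exists>\<theta>. args a = map (subst \<theta>) (args (head \<rho>))))"

definition edb_adorned_program :: "('p, 'c) drule set \<Rightarrow> ('p, 'c) arule set \<Rightarrow> bool" where
  "edb_adorned_program P P' \<longleftrightarrow> finite P' \<and>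
     (\<forall>R\<in>P'. \<forall>a\<in>insert (head R) (set (body R)).
        (\<exists>p. pred a = Edb p \<and> \<not> idb P p) \<or> edb_adorned_atom P a)"

definition bounded_by :: "('p, 'c) drule set \<Rightarrow> ('p, 'c) arule set \<Rightarrow> ('p, 'c) arule
    \<Rightarrow> ('p, 'c) wrule \<Rightarrow> bool" where
  "bounded_by P P' R \<rho> \<longleftrightarrow> (\<forall>D. edb_instance P D \<longrightarrow>
     (\<forall>ts. Atom (adorned \<rho>) ts \<in> derived_by R P' (edb_embed D) \<longrightarrow>
        Atom (pred (head \<rho>)) ts \<in> model {\<rho>} D))"

definition edb_bounded :: "('p, 'c) drule set \<Rightarrow> ('p, 'c) arule set \<Rightarrow> bool" where
  "edb_bounded P P' \<longleftrightarrow> (\<forall>R\<in>P'. \<exists>\<rho>. pred (head R) = adorned \<rho> \<and> bounded_by P P' R \<rho>)"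

definition preds :: "('p, 'c) drule set \<Rightarrow> 'p set" where
  "preds P = (\<Union>R\<in>P. pred ` insert (head R) (set (body R)))"

section \<open>The adornment algorithm\<close>

text \<open>\<open>candidate g P P' R'\<close>: the rule \<open>R'\<close> is constructed in one iteration of the algorithm, from a
  rule \<open>R\<close> of \<open>P\<close> and a choice \<open>\<rho>s\<close> of adornments. Here \<open>\<rho>s ! i\<close> is the representative for which the
  head of the chosen rule of \<open>P'\<close> and the head of the adornment have the same arguments, and
  \<open>\<rho>s' ! i\<close> is its renamed version. Only rules \<open>R\<close> with IDB head are processed, as \<open>q\<^sub>\<rho>\<close> is defined for
  IDB predicates \<open>q\<close> only; the remaining rules are EDB data.\<close>

definition candidate :: "(('p, 'c) wrule \<Rightarrow> ('p, 'c) wrule) \<Rightarrow> ('p, 'c) drule set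
    \<Rightarrow> ('p, 'c) arule set \<Rightarrow> ('p, 'c) arule \<Rightarrow> bool" where
  "candidate g P P' R' \<longleftrightarrow> (\<exists>R \<rho>s \<rho>s' \<sigma>.
     let ps = filter (\<lambda>a. idb P (pred a)) (body R);
         es = filter (\<lambda>a. \<not> idb P (pred a)) (body R);
         \<rho>0 = Rule (map_atom id (subst \<sigma>) (head R))
                (concat (map (\<lambda>\<rho>'. map (map_atom id (map_option (subst \<sigma>))) (body \<rho>')) \<rho>s')
                  @ map (map_atom id (Some \<circ> subst \<sigma>)) es)
     in R \<in> P \<and> idb P (pred (head R)) \<and>
        length \<rho>s = length ps \<and> length \<rho>s' = length ps \<and>
        (\<forall>i<length ps. pred (head (\<rho>s ! i)) = pred (ps ! i) \<and>
           (\<exists>Q\<in>P'. head Q = Atom (adorned (\<rho>s ! i)) (args (head (\<rho>s ! i)))) \<and>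
           variant (\<rho>s ! i) (\<rho>s' ! i) \<and>
           rule_vars (\<rho>s' ! i) \<inter> rule_vars (lift_rule R) = {} \<and>
           (\<forall>j<i. rule_vars (\<rho>s' ! i) \<inter> rule_vars (\<rho>s' ! j) = {})) \<and>
        mgu \<sigma> (zip (map args ps) (map (\<lambda>\<rho>'. args (head \<rho>')) \<rho>s')) \<and>
        R' = Rule (Atom (adorned (g \<rho>0)) (map (subst \<sigma>) (args (head R))))
               (map2 (\<lambda>p \<rho>. Atom (adorned \<rho>) (map (subst \<sigma>) (args p))) ps \<rho>s
                 @ map (map_atom Edb (subst \<sigma>)) es))"

definition adorn_step :: "(('p, 'c) wrule \<Rightarrow> ('p, 'c) wrule)
    \<Rightarrow> (('p, 'c) arule \<Rightarrow> ('p, 'c) arule set \<Rightarrow> bool) \<Rightarrow> ('p, 'c) drule set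
    \<Rightarrow> ('p, 'c) arule set \<Rightarrow> ('p, 'c) arule set \<Rightarrow> bool" where
  "adorn_step g h P P1 P2 \<longleftrightarrow> (\<exists>R'. candidate g P P1 R' \<and> \<not> h R' P1 \<and> P2 = insert R' P1)"

text \<open>The algorithm is non-deterministic: the order of iterations, the renamings and the most general
  unifiers are not fixed.\<close>

definition adornment_output :: "(('p, 'c) wrule \<Rightarrow> ('p, 'c) wrule)
    \<Rightarrow> (('p, 'c) arule \<Rightarrow> ('p, 'c) arule set \<Rightarrow> bool) \<Rightarrow> ('p, 'c) drule set
    \<Rightarrow> ('p, 'c) arule set \<Rightarrow> bool" where
  "adornment_output g h P P' \<longleftrightarrow> (adorn_step g h P)\<^sup>*\<^sup>* {} P' \<and> \<not> (\<exists>P2. adorn_step g h P P' P2)"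

definition g_relax :: "'c trm set \<Rightarrow> 'c trm option \<Rightarrow> 'c trm option" where
  "g_relax H t = (case t of None \<Rightarrow> None | Some t' \<Rightarrow> if t' \<in> H then Some t' else None)"

definition g_redundant :: "('p, 'c trm option) atom set \<Rightarrow> ('p, 'c trm option) atom \<Rightarrow> bool" where
  "g_redundant B a \<longleftrightarrow>
     (\<exists>b\<in>B. b \<noteq> a \<and> pred b = pred a \<and> list_all2 (\<lambda>t t'. t = t' \<or> t = None) (args a) (args b)) \<or>
     set (args a) \<subseteq> {None}"

definition g_out :: "('p, 'c) wrule \<Rightarrow> ('p, 'c) wrule" where
  "g_out \<rho> = (let B = map (map_atom id (g_relax (set (args (head \<rho>))))) (body \<rho>)
     in Rule (head \<rho>) (filter (\<lambda>a. \<not> g_redundant (set B) a) (remdups B)))"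

definition h_eq :: "('p, 'c) arule \<Rightarrow> ('p, 'c) arule set \<Rightarrow> bool" where
  "h_eq R' P' \<longleftrightarrow> (\<exists>R\<in>P'. variant (lift_rule R) (lift_rule R'))"

end

theory Submission
  imports Defs
begin

text \<open>If \<open>R\<close> and the renamed adornments are variable-disjoint, a valuation of \<open>R\<close> and matches of the
  adornments that agree on the IDB body atoms of \<open>R\<close> merge into one valuation. It is a ground unifier
  of the head equations, hence factors through the most general unifier \<open>\<sigma>\<close>. Read from the adorned
  rule to \<open>R\<close>, this shows by induction on derivations that every derived fact \<open>q\<^sub>\<rho>(t)\<close> comes with a
  match of the body of \<open>\<rho>\<close>, which is boundedness, as \<open>g_out\<close> only weakens bodies. Read from \<open>R\<close> to
  the adorned rule, it shows that every derivation over \<open>P\<close> can be adorned: a ground unifier exists,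
  hence so does a most general one, and at the fixpoint the resulting rule is in the output up to
  renaming. Dropping the adornments gives the converse inclusion.\<close>

section \<open>Terms, matching and least models\<close>

lemma tval_subst: "tval \<nu> (subst \<sigma> t) = tval (tval \<nu> \<circ> \<sigma>) t"
  by (cases t) auto

lemma subst_subst: "subst \<tau> (subst \<sigma> t) = subst (subst \<tau> \<circ> \<sigma>) t"
  by (cases t) auto

lemma tval_cong: "(\<And>x. t = Var x \<Longrightarrow> \<nu> x = \<mu> x) \<Longrightarrow> tval \<nu> t = tval \<mu> t"
  by (cases t) auto

lemma subst_Const_tval: "subst (Const \<circ> \<nu>) t = Const (tval \<nu> t)"
  by (cases t) auto

lemma subst_eq_VarD: "subst \<sigma> t = Var x \<Longrightarrow> \<exists>y. t = Var y \<and> \<sigma> y = Var x"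
  by (cases t) auto

lemma ground_sel [simp]:
  "pred (ground \<nu> a) = pred a" "args (ground \<nu> a) = map (tval \<nu>) (args a)"
  by (cases a; simp add: ground_def)+

lemma map_atom_sel [simp]:
  "pred (map_atom f g a) = f (pred a)" "args (map_atom f g a) = map g (args a)"
  by (cases a; simp)+

lemma lift_rule_sel [simp]:
  "head (lift_rule R) = head R" "body (lift_rule R) = map (map_atom id Some) (body R)"
  by (cases R; simp add: lift_rule_def atom.map_id)+

lemma rename_sel [simp]:
  "head (rename \<pi> R) = map_atom id (subst (Var \<circ> \<pi>)) (head R)"
  "body (rename \<pi> R) = map (map_atom id (map_option (subst (Var \<circ> \<pi>)))) (body R)"
  by (cases R; simp add: rename_def)+

lemma matches_lift [simp]: "matches \<nu> (map_atom id Some b) a \<longleftrightarrow> a = ground \<nu> b"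
  by (cases a; cases b)
    (auto simp: matches_def ground_def list_all2_conv_all_nth intro!: nth_equalityI)

lemma list_all2_matches_lift [simp]:
  "list_all2 (matches \<nu>) (map (map_atom id Some) bs) as \<longleftrightarrow> as = map (ground \<nu>) bs"
  by (auto simp: list_all2_conv_all_nth intro!: nth_equalityI)

text \<open>\<open>map_option\<close> keeps \<open>_\<close> as \<open>_\<close>, which matches
  everything, so the two valuations have to agree on the named arguments only.\<close>

lemma matches_map_option:
  assumes "\<And>t. Some t \<in> set (args b) \<Longrightarrow> tval \<nu> (f t) = tval \<mu> t"
  shows "matches \<nu> (map_atom id (map_option f) b) a \<longleftrightarrow> matches \<mu> b a"
proof -
  have "list_all2 (\<lambda>t c. case map_option f t of None \<Rightarrow> True | Some t' \<Rightarrow> tval \<nu> t' = c) (args b) (args a)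
    \<longleftrightarrow> list_all2 (\<lambda>t c. case t of None \<Rightarrow> True | Some t' \<Rightarrow> tval \<mu> t' = c) (args b) (args a)"
    using assms by (intro list.rel_cong) (auto split: option.split)
  then show ?thesis by (simp add: matches_def list.rel_map)
qed

text \<open>Once the valuation is fixed, the body atoms constrain each other no further, so their
  witnesses can be chosen atom by atom.\<close>

lemma list_all2_matches_ex:
  "(\<exists>as. list_all2 (matches \<nu>) bs as \<and> set as \<subseteq> D) \<longleftrightarrow> (\<forall>b\<in>set bs. \<exists>a\<in>D. matches \<nu> b a)"
proof (induction bs)
  case (Cons b bs)
  have "(\<exists>as. list_all2 (matches \<nu>) (b # bs) as \<and> set as \<subseteq> D) \<longleftrightarrow>
      (\<exists>a\<in>D. matches \<nu> b a) \<and> (\<exists>as. list_all2 (matches \<nu>) bs as \<and> set as \<subseteq> D)"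
    by (auto simp: list_all2_Cons1) (metis insert_subset list.set(2))
  with Cons show ?case by simp
qed simp

text \<open>A lifted rule contains no \<open>_\<close>, so the valuation alone determines the facts
  its body is matched with; they are the ground instances.\<close>

lemma model_lift_induct [consumes 1, case_names edb rule]:
  assumes "a \<in> model (lift_rule ` P) D"
    and "\<And>a. a \<in> D \<Longrightarrow> Q a"
    and "\<And>R \<nu>. R \<in> P \<Longrightarrow> (\<And>b. b \<in> set (body R) \<Longrightarrow> ground \<nu> b \<in> model (lift_rule ` P) D) \<Longrightarrow>
      (\<And>b. b \<in> set (body R) \<Longrightarrow> Q (ground \<nu> b)) \<Longrightarrow> Q (ground \<nu> (head R))"
  shows "Q a"
  using assms(1)
proof induction
  case (edb a)
  then show ?case by (rule assms(2))
next
  case (rule R \<nu> as)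
  then show ?case using assms(3) by fastforce
qed

lemma model_liftI:
  assumes "R \<in> P" "\<And>b. b \<in> set (body R) \<Longrightarrow> ground \<nu> b \<in> model (lift_rule ` P) D"
  shows "ground \<nu> (head R) \<in> model (lift_rule ` P) D"
  using model.rule[of "lift_rule R" "lift_rule ` P" \<nu> "map (ground \<nu>) (body R)" D] assms by auto

lemma model_lift_cases:
  assumes "a \<in> model (lift_rule ` P) D"
  obtains "a \<in> D" | R \<nu> where "R \<in> P" "a = ground \<nu> (head R)"
  using assms by (cases) auto

lemma derived_by_lift:
  "derived_by R P D = {ground \<nu> (head R) |\<nu>. \<forall>b\<in>set (body R). ground \<nu> b \<in> model (lift_rule ` P) D}"
  by (auto simp: derived_by_def)

text \<open>A rule whose head predicate is not IDB has an empty body, and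
  \<open>edb_instance\<close> puts its ground instances into \<open>D\<close>.\<close>

lemma edb_in_instance:
  assumes "edb_instance P D" "a \<in> model (lift_rule ` P) D" "\<not> idb P (pred a)"
  shows "a \<in> D"
  using assms(2,3,1) by (cases rule: model_lift_cases) (auto simp: edb_instance_def)

section \<open>Most general unifiers and fresh variants\<close>

lemma mgu_exists:
  fixes eqs :: "('c trm list \<times> 'c trm list) list"
  assumes "unifier \<theta> eqs"
  shows "\<exists>\<sigma>. mgu \<sigma> eqs"
proof -
  \<comment> \<open>The class of a term consists of the terms that every unifier identifies with it; a most general
    unifier selects a representative of each class, namely the constant if there is one.\<close>
  define cl where "cl t = {u. \<forall>\<theta>. unifier \<theta> eqs \<longrightarrow> subst \<theta> t = subst \<theta> u}" for t
  define rep where "rep S = (if \<exists>c. Const c \<in> S then Const (SOME c. Const c \<in> S) else SOME t. t \<in> S)"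
    for S :: "'c trm set"
  have rep_in: "rep (cl t) \<in> cl t" for t
  proof -
    have "t \<in> cl t" by (simp add: cl_def)
    then show ?thesis by (auto simp: rep_def intro: someI)
  qed
  \<comment> \<open>Two different constants in one class would be identified by the assumed unifier
    \<open>\<theta>\<close>, which fixes constants. Hence the \<open>SOME\<close> in
    \<open>rep\<close> has no choice here.\<close>
  have "rep (cl (Const c)) = Const c" for c
  proof -
    have "Const c \<in> cl (Const c)" by (simp add: cl_def)
    moreover have "d = c" if "Const d \<in> cl (Const c)" for d
      using that assms by (auto simp: cl_def)
    ultimately show ?thesis by (auto simp: rep_def)
  qed
  then have subst_rep: "subst (\<lambda>x. rep (cl (Var x))) t = rep (cl t)" for t
    by (cases t) auto
  have "map (\<lambda>t. rep (cl t)) s = map (\<lambda>t. rep (cl t)) t" if "(s, t) \<in> set eqs" for s t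
  proof (rule nth_equalityI)
    have *: "map (subst \<theta>) s = map (subst \<theta>) t" if "unifier \<theta> eqs" for \<theta>
      using that \<open>(s, t) \<in> set eqs\<close> by (auto simp: unifier_def)
    show len: "length (map (\<lambda>t. rep (cl t)) s) = length (map (\<lambda>t. rep (cl t)) t)"
      using map_eq_imp_length_eq[OF *[OF assms]] by simp
    fix i assume i: "i < length (map (\<lambda>t. rep (cl t)) s)"
    have "subst \<theta> (s ! i) = subst \<theta> (t ! i)" if "unifier \<theta> eqs" for \<theta>
      using arg_cong[OF *[OF that], of "\<lambda>l. l ! i"] i len by simp
    \<comment> \<open>\<open>rep\<close> sees only the class, so equal classes give equal
      representatives.\<close>
    then have "cl (s ! i) = cl (t ! i)" by (auto simp: cl_def)
    then show "map (\<lambda>t. rep (cl t)) s ! i = map (\<lambda>t. rep (cl t)) t ! i" using i len by simp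
  qed
  then have "unifier (\<lambda>x. rep (cl (Var x))) eqs"
    by (auto simp: unifier_def subst_rep cong: map_cong)
  \<comment> \<open>Most generality: the factor \<open>\<tau>\<close> can be \<open>\<theta>\<close>
    itself, because \<open>\<theta>\<close> does not distinguish a variable from its
    representative.\<close>
  moreover have "\<theta> x = subst \<theta> (rep (cl (Var x)))" if "unifier \<theta> eqs" for \<theta> x
    using that rep_in[of "Var x"] by (auto simp: cl_def)
  ultimately show ?thesis unfolding mgu_def by blast
qed

text \<open>The ground unifier factors as some \<open>\<tau>\<close> after \<open>\<sigma>\<close>.
  This \<open>\<tau>\<close> sends every variable occurring in a term \<open>\<sigma> x\<close> to a
  constant, and \<open>\<kappa>\<close> reads these constants off.\<close>

lemma mgu_ground:
  assumes "mgu \<sigma> eqs" "unifier (Const \<circ> \<mu>) eqs"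
  obtains \<kappa> where "\<And>t. tval \<kappa> (subst \<sigma> t) = tval \<mu> t"
proof -
  from assms obtain \<tau> where \<tau>: "\<And>x. Const (\<mu> x) = subst \<tau> (\<sigma> x)"
    unfolding mgu_def comp_def by metis
  \<comment> \<open>If \<open>\<tau> y\<close> is not a constant, the value is arbitrary; such a
    \<open>y\<close> is no \<open>\<sigma> x\<close>.\<close>
  define \<kappa> where "\<kappa> y = (THE c. \<tau> y = Const c)" for y
  have "tval \<kappa> (\<sigma> x) = \<mu> x" for x
    using \<tau>[of x] by (cases "\<sigma> x") (auto simp: \<kappa>_def dest: sym)
  then have "tval \<kappa> (subst \<sigma> t) = tval \<mu> t" for t
    by (cases t) auto
  then show ?thesis by (rule that)
qed

lemma merge_valuations:
  fixes n :: nat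
  assumes "\<And>i. i < n \<Longrightarrow> Vs i \<inter> V = {}" "\<And>i j. i < n \<Longrightarrow> j < i \<Longrightarrow> Vs i \<inter> Vs j = {}"
  obtains \<mu> where "\<And>x. x \<in> V \<Longrightarrow> \<mu> x = \<nu> x" "\<And>i x. i < n \<Longrightarrow> x \<in> Vs i \<Longrightarrow> \<mu> x = \<nu>s i x"
proof
  \<comment> \<open>Disjointness makes the index \<open>i\<close> unique. For variables outside all
    the sets the value is arbitrary.\<close>
  define \<mu> where "\<mu> x = (if x \<in> V then \<nu> x else \<nu>s (THE i. i < n \<and> x \<in> Vs i) x)" for x
  show "\<mu> x = \<nu> x" if "x \<in> V" for x
    using that by (simp add: \<mu>_def)
  show "\<mu> x = \<nu>s i x" if "i < n" "x \<in> Vs i" for i x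
  proof -
    have "(THE i. i < n \<and> x \<in> Vs i) = i"
      using that assms(2) by (intro the_equality) (auto, metis disjoint_iff linorder_neqE_nat)
    moreover have "x \<notin> V" using that assms(1) by auto
    ultimately show ?thesis by (simp add: \<mu>_def)
  qed
qed

lemma finite_rule_vars: "finite (rule_vars R)"
proof -
  have "rule_vars R \<subseteq> {x. Var x \<in> set (args (head R))} \<union>
      (\<Union>b\<in>set (body R). {x. Some (Var x) \<in> set (args b)})"
    by (auto simp: rule_vars_def)
  moreover have "finite {x. Var x \<in> set (args (head R))}"
    using finite_vimageI[of "set (args (head R))" Var] by (simp add: vimage_def inj_def)
  moreover have "finite {x. Some (Var x) \<in> set (args b)}" for b :: "('a, 'b trm option) atom"
    using finite_vimageI[of "set (args b)" "Some \<circ> Var"] by (simp add: vimage_def inj_def)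
  ultimately show ?thesis by (meson finite_UN_I finite_UnI finite_set finite_subset)
qed

lemma rule_vars_rename: "rule_vars (rename \<pi> R) = \<pi> ` rule_vars R"
proof -
  have *: "Var x = subst (Var \<circ> \<pi>) t \<longleftrightarrow> (\<exists>y. x = \<pi> y \<and> t = Var y)" for x and t :: "'b trm"
    by (cases t) auto
  have head: "Var x \<in> subst (Var \<circ> \<pi>) ` S \<longleftrightarrow> (\<exists>y. x = \<pi> y \<and> Var y \<in> S)" for x and S :: "'b trm set"
    unfolding image_iff by (metis *)
  have "Some (Var x) = map_option (subst (Var \<circ> \<pi>)) t \<longleftrightarrow> (\<exists>y. x = \<pi> y \<and> t = Some (Var y))"
    for x and t :: "'b trm option"
    by (cases t) (auto simp: *)
  then have body: "Some (Var x) \<in> map_option (subst (Var \<circ> \<pi>)) ` S \<longleftrightarrow>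
      (\<exists>y. x = \<pi> y \<and> Some (Var y) \<in> S)" for x and S :: "'b trm option set"
    unfolding image_iff by metis
  show ?thesis
    by (rule set_eqI) (simp add: rule_vars_def head body, blast)
qed

lemma bij_avoiding:
  fixes V F :: "nat set"
  assumes "finite V" "finite F"
  obtains \<pi> where "bij \<pi>" "\<pi> ` V \<inter> F = {}"
proof -
  obtain N where N: "\<forall>x\<in>V \<union> F. x < N"
    using assms finite_nat_set_iff_bounded by (metis finite_UnI)
  \<comment> \<open>Swapping the blocks \<open>[0, N)\<close> and \<open>[N, 2N)\<close> is an
    involution. A mere shift by \<open>N\<close> would not be onto, whereas \<open>variant\<close>
    asks for a bijection.\<close>
  define \<pi> where "\<pi> x = (if x < N then x + N else if x < 2 * N then x - N else x)" for x
  have "\<pi> \<circ> \<pi> = id" by (auto simp: \<pi>_def fun_eq_iff)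
  then have "bij \<pi>" by (rule o_bij) (fact \<open>\<pi> \<circ> \<pi> = id\<close>)
  moreover have "\<pi> ` V \<inter> F = {}" using N by (fastforce simp: \<pi>_def)
  ultimately show ?thesis by (rule that)
qed

text \<open>The adornments are renamed one after the other, each away from \<open>F\<close> and from
  all earlier renamed ones. Induction from the right end fits the condition on
  \<open>j < i\<close>.\<close>

lemma fresh_variants:
  assumes "finite F"
  shows "\<exists>\<rho>s'. length \<rho>s' = length \<rho>s \<and> (\<forall>i<length \<rho>s. variant (\<rho>s ! i) (\<rho>s' ! i) \<and>
    rule_vars (\<rho>s' ! i) \<inter> F = {} \<and> (\<forall>j<i. rule_vars (\<rho>s' ! i) \<inter> rule_vars (\<rho>s' ! j) = {}))"
proof (induction \<rho>s rule: rev_induct)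
  case (snoc \<rho> \<rho>s)
  then obtain \<rho>s' where \<rho>s': "length \<rho>s' = length \<rho>s" "\<forall>i<length \<rho>s. variant (\<rho>s ! i) (\<rho>s' ! i) \<and>
    rule_vars (\<rho>s' ! i) \<inter> F = {} \<and> (\<forall>j<i. rule_vars (\<rho>s' ! i) \<inter> rule_vars (\<rho>s' ! j) = {})"
    by blast
  obtain \<pi> where \<pi>: "bij \<pi>" "\<pi> ` rule_vars \<rho> \<inter> (F \<union> \<Union> (rule_vars ` set \<rho>s')) = {}"
    using bij_avoiding[of "rule_vars \<rho>" "F \<union> \<Union> (rule_vars ` set \<rho>s')"] assms finite_rule_vars
    by blast
  have "variant \<rho> (rename \<pi> \<rho>)" using \<pi>(1) by (auto simp: variant_def)
  moreover have "rule_vars (rename \<pi> \<rho>) \<inter> F = {}" using \<pi>(2) by (auto simp: rule_vars_rename)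
  moreover have "rule_vars (rename \<pi> \<rho>) \<inter> rule_vars (\<rho>s' ! j) = {}" if "j < length \<rho>s" for j
    using \<pi>(2) that \<rho>s'(1) nth_mem[of j \<rho>s'] unfolding rule_vars_rename by auto
  ultimately show ?case
    using \<rho>s' by (intro exI[of _ "\<rho>s' @ [rename \<pi> \<rho>]"]) (auto simp: nth_append less_Suc_eq)
qed simp

section \<open>Adornments up to renaming\<close>

lemma adorned_eq_iff [simp]: "adorned \<rho> = adorned \<rho>' \<longleftrightarrow> variant \<rho> \<rho>'"
  by (simp add: adorned_def adornment.abs_eq_iff)

lemma adorned_neq_Edb [simp]: "adorned \<rho> \<noteq> Edb p" "Edb p \<noteq> adorned \<rho>"
  by (simp_all add: adorned_def)

lemma variant_refl [simp]: "variant R R"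
  using equivp_variant by (rule equivp_reflp)

lemma variant_sym: "variant R R' \<Longrightarrow> variant R' R"
  using equivp_variant by (metis equivp_symp)

lemma variant_pred_head: "variant \<rho> \<rho>' \<Longrightarrow> pred (head \<rho>') = pred (head \<rho>)"
  by (auto simp: variant_def)

lemma variant_args_head:
  "variant \<rho> \<rho>' \<Longrightarrow> \<exists>\<theta>. args (head \<rho>') = map (subst \<theta>) (args (head \<rho>))"
  by (auto simp: variant_def)

lemma variant_body_preds: "variant \<rho> \<rho>' \<Longrightarrow> pred ` set (body \<rho>') = pred ` set (body \<rho>)"
  by (auto simp: variant_def image_image)

text \<open>An adorned predicate fixes its adornment only up to renaming, so whatever is used of an
  adornment has to pass to every variant.\<close>

lemma variant_safe:
  assumes "variant \<rho> \<rho>'" "safe \<rho>"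
  shows "safe \<rho>'"
proof -
  obtain \<pi> where \<rho>': "\<rho>' = rename \<pi> \<rho>" using assms(1) by (auto simp: variant_def)
  show ?thesis unfolding safe_def
  proof (intro allI impI)
    fix x assume "Var x \<in> set (args (head \<rho>'))"
    then obtain y where "x = \<pi> y" "Var y \<in> set (args (head \<rho>))"
      by (auto simp: \<rho>' dest!: sym[of "Var x"] subst_eq_VarD)
    moreover then obtain b where "b \<in> set (body \<rho>)" "Some (Var y) \<in> set (args b)"
      using assms(2) by (auto simp: safe_def)
    ultimately show "\<exists>b\<in>set (body \<rho>'). Some (Var x) \<in> set (args b)"
      by (force simp: \<rho>' image_iff intro!: bexI[of _ b] bexI[of _ "Some (Var y)"])
  qed
qed

text \<open>Each body atom has its own witness, instead of one list of matched facts as in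
  \<open>model\<close>; this form survives concatenating, permuting and filtering bodies.\<close>

definition sat :: "('p, 'c) atom set \<Rightarrow> (nat \<Rightarrow> 'c) \<Rightarrow> ('p, 'c) wrule \<Rightarrow> bool" where
  "sat D \<nu> \<rho> \<longleftrightarrow> (\<forall>b\<in>set (body \<rho>). \<exists>a\<in>D. matches \<nu> b a)"

lemma sat_model:
  assumes "sat D \<nu> \<rho>"
  shows "ground \<nu> (head \<rho>) \<in> model {\<rho>} D"
proof -
  obtain as where "list_all2 (matches \<nu>) (body \<rho>) as" "set as \<subseteq> D"
    using assms unfolding sat_def list_all2_matches_ex[symmetric] by blast
  then show ?thesis
    by (intro model.rule[of \<rho> _ \<nu> as]) (auto intro: model.edb)
qed

text \<open>Compose the valuation with the inverse renaming. The implication in the second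
  conclusion lets the lemma serve also where only heads are compared.\<close>

lemma variant_valuation:
  fixes \<rho> :: "('p, 'c) wrule"
  assumes "variant \<rho> \<rho>'"
  obtains \<nu>' where "map (tval \<nu>') (args (head \<rho>')) = map (tval \<nu>) (args (head \<rho>))"
    "sat D \<nu> \<rho> \<Longrightarrow> sat D \<nu>' \<rho>'"
proof -
  obtain \<pi> where \<pi>: "bij \<pi>" "\<rho>' = rename \<pi> \<rho>" using assms by (auto simp: variant_def)
  have inv: "tval (\<nu> \<circ> inv \<pi>) (subst (Var \<circ> \<pi>) t) = tval \<nu> t" for t :: "'c trm"
    using \<pi>(1) by (cases t) (auto simp: bij_is_inj)
  show ?thesis
  proof
    show "map (tval (\<nu> \<circ> inv \<pi>)) (args (head \<rho>')) = map (tval \<nu>) (args (head \<rho>))"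
      by (simp add: \<pi>(2) inv)
    show "sat D (\<nu> \<circ> inv \<pi>) \<rho>'" if "sat D \<nu> \<rho>"
      using that unfolding sat_def \<pi>(2) by (auto simp: matches_map_option[OF inv])
  qed
qed

section \<open>The relaxation \<open>g_out\<close>: weaker bodies, preserved safety\<close>

lemma g_out_head [simp]: "head (g_out \<rho>) = head \<rho>"
  by (simp add: g_out_def Let_def)

lemma g_out_body_preds: "b \<in> set (body (g_out \<rho>)) \<Longrightarrow> \<exists>b'\<in>set (body \<rho>). pred b = pred b'"
  by (auto simp: g_out_def Let_def)

lemma matches_g_relax:
  "matches \<nu> b a \<Longrightarrow> matches \<nu> (map_atom id (g_relax H) b) a"
  by (cases a; cases b)
    (auto simp: matches_def list_all2_conv_all_nth g_relax_def split: option.splits if_splits)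

lemma sat_g_out: "sat D \<nu> \<rho> \<Longrightarrow> sat D \<nu> (g_out \<rho>)"
  unfolding sat_def g_out_def Let_def using matches_g_relax by fastforce

text \<open>Among the atoms containing \<open>Some t\<close>, one with the most named arguments is
  not redundant: an atom subsuming it also contains \<open>Some t\<close>, and is either equal to it
  or has more named arguments.\<close>

lemma non_redundant_above:
  assumes "finite B" "a \<in> B" "Some t \<in> set (args a)"
  shows "\<exists>b\<in>B. \<not> g_redundant B b \<and> Some t \<in> set (args b)"
proof -
  let ?n = "\<lambda>a. length (filter (\<lambda>t. t \<noteq> None) (args a))"
  let ?S = "{b \<in> B. Some t \<in> set (args b)}"
  have "finite ?S" "?S \<noteq> {}" using assms by auto
  then have "Max (?n ` ?S) \<in> ?n ` ?S" by (intro Max_in) auto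
  then obtain b where b: "b \<in> ?S" and "?n b = Max (?n ` ?S)" by auto
  then have max: "?n c \<le> ?n b" if "c \<in> ?S" for c
    using that \<open>finite ?S\<close> by simp
  have "\<not> g_redundant B b"
  proof
    assume "g_redundant B b"
    \<comment> \<open>This excludes the second way of being redundant, so a subsuming atom
      \<open>c\<close> must exist.\<close>
    moreover have "\<not> set (args b) \<subseteq> {None}" using b by auto
    ultimately obtain c where c: "c \<in> B" "c \<noteq> b" "pred c = pred b"
      and le: "list_all2 (\<lambda>t t'. t = t' \<or> t = None) (args b) (args c)"
      by (auto simp: g_redundant_def)
    have "Some t \<in> set (args c)"
      using b le by (force simp: list_all2_conv_all_nth in_set_conv_nth)
    then have "?n c \<le> ?n b" using c(1) max by auto
    \<comment> \<open>Subsumption can change an argument only from \<open>_\<close> to a named one,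
      so every change increases the count.\<close>
    have "xs = ys \<or> length (filter (\<lambda>t. t \<noteq> None) xs) < length (filter (\<lambda>t. t \<noteq> None) ys)"
      if "list_all2 (\<lambda>t t'. t = t' \<or> t = None) xs ys" for xs ys :: "'b trm option list"
      using that by (induction) auto
    from this[OF le] \<open>?n c \<le> ?n b\<close> have "args b = args c" by simp
    with c show False by (metis atom.expand)
  qed
  with b show ?thesis by auto
qed

text \<open>Head variables are never relaxed to \<open>_\<close>, and for every removed atom
  containing one a non-redundant atom containing it remains.\<close>

lemma g_out_safe:
  assumes "safe \<rho>"
  shows "safe (g_out \<rho>)"
  unfolding safe_def g_out_head
proof (intro allI impI)
  fix x assume x: "Var x \<in> set (args (head \<rho>))"
  let ?g = "map_atom id (g_relax (set (args (head \<rho>))))"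
  obtain b where b: "b \<in> set (body \<rho>)" "Some (Var x) \<in> set (args b)"
    using assms x by (auto simp: safe_def)
  have "Some (Var x) \<in> set (args (?g b))"
    using b(2) x by (force simp: g_relax_def intro!: image_eqI[of _ _ "Some (Var x)"])
  then show "\<exists>b\<in>set (body (g_out \<rho>)). Some (Var x) \<in> set (args b)"
    using non_redundant_above[of "set (map ?g (body \<rho>))" "?g b" "Var x"] b(1)
    by (auto simp: g_out_def Let_def)
qed

section \<open>The rules generated by the algorithm\<close>

abbreviation idb_body :: "('p, 'c) drule set \<Rightarrow> ('p, 'c) drule \<Rightarrow> ('p, 'c trm) atom list" where
  "idb_body P R \<equiv> filter (\<lambda>a. idb P (pred a)) (body R)"

abbreviation edb_body :: "('p, 'c) drule set \<Rightarrow> ('p, 'c) drule \<Rightarrow> ('p, 'c trm) atom list" where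
  "edb_body P R \<equiv> filter (\<lambda>a. \<not> idb P (pred a)) (body R)"

definition head_eqs where
  "head_eqs P R \<rho>s' = zip (map args (idb_body P R)) (map (\<lambda>\<rho>'. args (head \<rho>')) \<rho>s')"

text \<open>The rule \<open>\<rho>0\<close> of the algorithm, before relaxation.\<close>

definition unfolded :: "('p, 'c) drule set \<Rightarrow> ('p, 'c) drule \<Rightarrow> ('p, 'c) wrule list
    \<Rightarrow> (nat \<Rightarrow> 'c trm) \<Rightarrow> ('p, 'c) wrule" where
  "unfolded P R \<rho>s' \<sigma> = Rule (map_atom id (subst \<sigma>) (head R))
     (concat (map (\<lambda>\<rho>'. map (map_atom id (map_option (subst \<sigma>))) (body \<rho>')) \<rho>s')
       @ map (map_atom id (Some \<circ> subst \<sigma>)) (edb_body P R))"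

text \<open>The rule \<open>R'\<close> of the algorithm. The adornment of the head is a parameter,
  so that facts about the body do not mention \<open>g\<close>.\<close>

definition adorned_rule :: "('p, 'c) drule set \<Rightarrow> ('p, 'c) drule \<Rightarrow> ('p, 'c) wrule list
    \<Rightarrow> ('p, 'c) wrule \<Rightarrow> (nat \<Rightarrow> 'c trm) \<Rightarrow> ('p, 'c) arule" where
  "adorned_rule P R \<rho>s \<rho> \<sigma> = Rule (Atom (adorned \<rho>) (map (subst \<sigma>) (args (head R))))
     (map2 (\<lambda>p \<rho>. Atom (adorned \<rho>) (map (subst \<sigma>) (args p))) (idb_body P R) \<rho>s
       @ map (map_atom Edb (subst \<sigma>)) (edb_body P R))"

text \<open>The conditions of \<open>candidate\<close> that precede unification; the completeness
  proof first builds a choice and then finds its unifier.\<close>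

definition choice :: "('p, 'c) drule set \<Rightarrow> ('p, 'c) arule set \<Rightarrow> ('p, 'c) drule
    \<Rightarrow> ('p, 'c) wrule list \<Rightarrow> ('p, 'c) wrule list \<Rightarrow> bool" where
  "choice P P' R \<rho>s \<rho>s' \<longleftrightarrow>
     length \<rho>s = length (idb_body P R) \<and> length \<rho>s' = length (idb_body P R) \<and>
     (\<forall>i<length (idb_body P R). pred (head (\<rho>s ! i)) = pred (idb_body P R ! i) \<and>
        (\<exists>Q\<in>P'. head Q = Atom (adorned (\<rho>s ! i)) (args (head (\<rho>s ! i)))) \<and>
        variant (\<rho>s ! i) (\<rho>s' ! i) \<and>
        rule_vars (\<rho>s' ! i) \<inter> rule_vars (lift_rule R) = {} \<and>
        (\<forall>j<i. rule_vars (\<rho>s' ! i) \<inter> rule_vars (\<rho>s' ! j) = {}))"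

lemma candidate_iff:
  "candidate g P P' R' \<longleftrightarrow> (\<exists>R \<rho>s \<rho>s' \<sigma>. R \<in> P \<and> idb P (pred (head R)) \<and> choice P P' R \<rho>s \<rho>s' \<and>
     mgu \<sigma> (head_eqs P R \<rho>s') \<and> R' = adorned_rule P R \<rho>s (g (unfolded P R \<rho>s' \<sigma>)) \<sigma>)"
  unfolding candidate_def Let_def choice_def head_eqs_def unfolded_def adorned_rule_def
  by (simp only: conj_assoc)

text \<open>The program built so far enters only positively, as the supply of head atoms to choose
  from.\<close>

lemma candidate_mono:
  assumes "P1 \<subseteq> P2" "candidate g P P1 R'"
  shows "candidate g P P2 R'"
proof -
  have "choice P P1 R \<rho>s \<rho>s' \<Longrightarrow> choice P P2 R \<rho>s \<rho>s'" for R \<rho>s \<rho>s'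
    using assms(1) unfolding choice_def by blast
  with assms(2) show ?thesis unfolding candidate_iff by blast
qed

section \<open>Runs of the algorithm\<close>

lemma output_finite:
  assumes "adornment_output g h P P'"
  shows "finite P'"
proof -
  have "(adorn_step g h P)\<^sup>*\<^sup>* {} P'" using assms by (simp add: adornment_output_def)
  then show ?thesis by induction (auto simp: adorn_step_def)
qed

text \<open>The choices of a candidate are made among the rules generated before it, so properties of the
  generated rules are proved by induction along the run of the algorithm.\<close>

lemma output_induct [consumes 2, case_names candidate]:
  assumes "adornment_output g h P P'" "Q \<in> P'"
    and "\<And>P1 Q. (\<And>Q'. Q' \<in> P1 \<Longrightarrow> Pr Q') \<Longrightarrow> P1 \<subseteq> P' \<Longrightarrow> candidate g P P1 Q \<Longrightarrow> Pr Q"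
  shows "Pr Q"
proof -
  have "(adorn_step g h P)\<^sup>*\<^sup>* {} P'" using assms(1) by (simp add: adornment_output_def)
  moreover have "P1 \<subseteq> P' \<Longrightarrow> \<forall>Q\<in>P1. Pr Q" if "(adorn_step g h P)\<^sup>*\<^sup>* {} P1" for P1
    using that
  proof induction
    case (step P1 P2)
    then show ?case using assms(3)[of P1] by (auto simp: adorn_step_def)
  qed simp
  ultimately show ?thesis using assms(2) by blast
qed

text \<open>By monotonicity, the stage at which a rule was generated can be forgotten: its choices
  are also choices among the final rules.\<close>

lemma output_candidate:
  assumes "adornment_output g h P P'" "Q \<in> P'"
  shows "candidate g P P' Q"
  using assms by (induction rule: output_induct) (blast intro: candidate_mono)

lemma set_adorned_rule_body:
  assumes "length \<rho>s = length (idb_body P R)"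
  shows "set (body (adorned_rule P R \<rho>s \<rho> \<sigma>)) =
    {Atom (adorned (\<rho>s ! i)) (map (subst \<sigma>) (args (idb_body P R ! i))) |i. i < length (idb_body P R)} \<union>
    map_atom Edb (subst \<sigma>) ` set (edb_body P R)"
  using assms by (auto simp: adorned_rule_def set_zip)

lemma adorned_idb_atom:
  assumes "length \<rho>s = length (idb_body P R)" "i < length (idb_body P R)"
  shows "Atom (adorned (\<rho>s ! i)) (map (subst \<sigma>) (args (idb_body P R ! i)))
    \<in> set (body (adorned_rule P R \<rho>s \<rho> \<sigma>))"
  using assms unfolding set_adorned_rule_body[OF assms(1)] by blast

lemma set_unfolded_body:
  "set (body (unfolded P R \<rho>s' \<sigma>)) =
    (\<Union>\<rho>'\<in>set \<rho>s'. map_atom id (map_option (subst \<sigma>)) ` set (body \<rho>')) \<union>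
    map_atom id (Some \<circ> subst \<sigma>) ` set (edb_body P R)"
  by (simp add: unfolded_def)

lemma unfolded_head [simp]:
  "head (unfolded P R \<rho>s' \<sigma>) = map_atom id (subst \<sigma>) (head R)"
  by (simp add: unfolded_def)

lemma adorned_rule_head [simp]:
  "head (adorned_rule P R \<rho>s \<rho> \<sigma>) = Atom (adorned \<rho>) (map (subst \<sigma>) (args (head R)))"
  by (simp add: adorned_rule_def)

section \<open>Joint valuations of a rule and its chosen adornments\<close>

lemma unifier_head_eqs:
  assumes "length \<rho>s' = length (idb_body P R)"
  shows "unifier \<sigma> (head_eqs P R \<rho>s') \<longleftrightarrow> (\<forall>i<length (idb_body P R).
    map (subst \<sigma>) (args (idb_body P R ! i)) = map (subst \<sigma>) (args (head (\<rho>s' ! i))))"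
  using assms unfolding unifier_def head_eqs_def zip_map_map by (auto simp: set_zip)

lemma body_cases:
  assumes "b \<in> set (body R)"
  obtains i where "i < length (idb_body P R)" "b = idb_body P R ! i" "idb P (pred b)"
  | "b \<in> set (edb_body P R)" "\<not> idb P (pred b)"
proof (cases "idb P (pred b)")
  case True
  then have "b \<in> set (idb_body P R)" using assms by simp
  then show ?thesis using True that(1) by (metis in_set_conv_nth)
qed (use assms that(2) in simp)

text \<open>\<open>\<mu>\<close> merges \<open>\<nu>\<close> on the variables of \<open>R\<close>
  with \<open>\<nu>s i\<close> on those of the \<open>i\<close>-th renamed adornment. By
  \<open>eq\<close> it equates both sides of each head equation, so substituting its constants is a
  unifier.\<close>

lemma ground_unify:
  assumes "length \<rho>s' = length (idb_body P R)"
    and disj: "\<And>i. i < length (idb_body P R) \<Longrightarrow> rule_vars (\<rho>s' ! i) \<inter> rule_vars (lift_rule R) = {}"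
      "\<And>i j. i < length (idb_body P R) \<Longrightarrow> j < i \<Longrightarrow> rule_vars (\<rho>s' ! i) \<inter> rule_vars (\<rho>s' ! j) = {}"
    and eq: "\<And>i. i < length (idb_body P R) \<Longrightarrow>
      map (tval \<nu>) (args (idb_body P R ! i)) = map (tval (\<nu>s i)) (args (head (\<rho>s' ! i)))"
  obtains \<mu> where "unifier (Const \<circ> \<mu>) (head_eqs P R \<rho>s')"
    "\<And>a. a \<in> insert (head R) (set (body R)) \<Longrightarrow> map (tval \<mu>) (args a) = map (tval \<nu>) (args a)"
    "\<And>i b t. i < length (idb_body P R) \<Longrightarrow> b \<in> set (body (\<rho>s' ! i)) \<Longrightarrow> Some t \<in> set (args b) \<Longrightarrow>
      tval \<mu> t = tval (\<nu>s i) t"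
proof -
  obtain \<mu> where \<mu>: "\<And>x. x \<in> rule_vars (lift_rule R) \<Longrightarrow> \<mu> x = \<nu> x"
    "\<And>i x. i < length (idb_body P R) \<Longrightarrow> x \<in> rule_vars (\<rho>s' ! i) \<Longrightarrow> \<mu> x = \<nu>s i x"
    using merge_valuations[of "length (idb_body P R)" "\<lambda>i. rule_vars (\<rho>s' ! i)"
      "rule_vars (lift_rule R)" \<nu> \<nu>s, OF disj] by blast
  have R: "map (tval \<mu>) (args a) = map (tval \<nu>) (args a)"
    if "a \<in> insert (head R) (set (body R))" for a
    using that by (force simp: rule_vars_def intro!: tval_cong \<mu>(1))
  have "map (tval \<mu>) (args (head (\<rho>s' ! i))) = map (tval (\<nu>s i)) (args (head (\<rho>s' ! i)))"
    if "i < length (idb_body P R)" for i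
    using that by (auto simp: rule_vars_def intro!: tval_cong \<mu>(2))
  moreover have "map (tval \<mu>) (args (idb_body P R ! i)) = map (tval \<nu>) (args (idb_body P R ! i))"
    if "i < length (idb_body P R)" for i
    using nth_mem[OF that] by (intro R) simp
  ultimately have "map (tval \<mu>) (args (idb_body P R ! i)) = map (tval \<mu>) (args (head (\<rho>s' ! i)))"
    if "i < length (idb_body P R)" for i
    using that eq by simp
  moreover have map_Const: "map (subst (Const \<circ> \<mu>)) ts = map Const (map (tval \<mu>) ts)" for ts
    by (simp add: subst_Const_tval)
  ultimately have "unifier (Const \<circ> \<mu>) (head_eqs P R \<rho>s')"
    unfolding unifier_head_eqs[OF assms(1)] map_Const by metis
  moreover have "tval \<mu> t = tval (\<nu>s i) t"
    if "i < length (idb_body P R)" "b \<in> set (body (\<rho>s' ! i))" "Some t \<in> set (args b)" for i b t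
    using that by (auto simp: rule_vars_def intro!: tval_cong \<mu>(2))
  ultimately show ?thesis using R that by blast
qed

lemma edb_embed_pred: "a \<in> edb_embed D \<Longrightarrow> \<exists>p. pred a = Edb p \<and> Atom p (args a) \<in> D"
  unfolding edb_embed_def by auto

lemma Edb_in_edb_embed: "a \<in> D \<Longrightarrow> Atom (Edb (pred a)) (args a) \<in> edb_embed D"
  by (cases a) (force simp: edb_embed_def)

text \<open>All heads of generated rules are adorned, so a fact with an EDB predicate can only stem
  from the instance.\<close>

lemma output_edb_model:
  assumes "adornment_output g h P P'" "a \<in> model (lift_rule ` P') (edb_embed D)" "pred a = Edb p"
  shows "Atom p (args a) \<in> D"
  using assms(2)
proof (cases rule: model_lift_cases)
  case 1
  then show ?thesis using edb_embed_pred assms(3) by fastforce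
next
  case (2 Q \<nu>)
  then show ?thesis
    using output_candidate[OF assms(1)] assms(3) by (fastforce simp: candidate_iff adorned_def)
qed

text \<open>The core of boundedness: a true instance of the body of \<open>R\<close>, together with
  matches in \<open>D\<close> of the chosen adornments, yields a match of the combined body with the
  same head values.\<close>

lemma unfolded_sat:
  assumes choice: "choice P P' R \<rho>s \<rho>s'" and mgu: "mgu \<sigma> (head_eqs P R \<rho>s')"
    and idb: "\<And>i. i < length (idb_body P R) \<Longrightarrow>
      \<exists>\<nu>'. map (tval \<nu>') (args (head (\<rho>s ! i))) = map (tval \<nu>) (args (idb_body P R ! i)) \<and> sat D \<nu>' (\<rho>s ! i)"
    and edb: "\<And>b. b \<in> set (edb_body P R) \<Longrightarrow> ground \<nu> b \<in> D"
  obtains \<kappa> where "map (tval \<kappa>) (args (head (unfolded P R \<rho>s' \<sigma>))) = map (tval \<nu>) (args (head R))"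
    "sat D \<kappa> (unfolded P R \<rho>s' \<sigma>)"
proof -
  let ?n = "length (idb_body P R)"
  have "\<exists>\<nu>'. map (tval \<nu>) (args (idb_body P R ! i)) = map (tval \<nu>') (args (head (\<rho>s' ! i))) \<and> sat D \<nu>' (\<rho>s' ! i)"
    if "i < ?n" for i
  proof -
    have "variant (\<rho>s ! i) (\<rho>s' ! i)" using choice that by (simp add: choice_def)
    then show ?thesis using idb[OF that] by (metis variant_valuation)
  qed
  then obtain \<nu>s where \<nu>s:
    "\<And>i. i < ?n \<Longrightarrow> map (tval \<nu>) (args (idb_body P R ! i)) = map (tval (\<nu>s i)) (args (head (\<rho>s' ! i)))"
    "\<And>i. i < ?n \<Longrightarrow> sat D (\<nu>s i) (\<rho>s' ! i)"
    by metis
  have len: "length \<rho>s' = ?n"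
    and disj: "\<And>i. i < ?n \<Longrightarrow> rule_vars (\<rho>s' ! i) \<inter> rule_vars (lift_rule R) = {}"
      "\<And>i j. i < ?n \<Longrightarrow> j < i \<Longrightarrow> rule_vars (\<rho>s' ! i) \<inter> rule_vars (\<rho>s' ! j) = {}"
    using choice by (simp_all add: choice_def)
  obtain \<mu> where \<mu>: "unifier (Const \<circ> \<mu>) (head_eqs P R \<rho>s')"
    "\<And>a. a \<in> insert (head R) (set (body R)) \<Longrightarrow> map (tval \<mu>) (args a) = map (tval \<nu>) (args a)"
    "\<And>i b t. i < ?n \<Longrightarrow> b \<in> set (body (\<rho>s' ! i)) \<Longrightarrow> Some t \<in> set (args b) \<Longrightarrow>
      tval \<mu> t = tval (\<nu>s i) t"
    using ground_unify[OF len disj \<nu>s(1)] by blast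
  obtain \<kappa> where \<kappa>: "\<And>t. tval \<kappa> (subst \<sigma> t) = tval \<mu> t"
    using mgu_ground[OF mgu \<mu>(1)] by blast
  have map_\<kappa>: "map (tval \<kappa>) (map (subst \<sigma>) ts) = map (tval \<mu>) ts" for ts
    by (simp add: \<kappa>)
  show ?thesis
  proof
    show "map (tval \<kappa>) (args (head (unfolded P R \<rho>s' \<sigma>))) = map (tval \<nu>) (args (head R))"
      using map_\<kappa> \<mu>(2)[of "head R"] by simp
    have "\<exists>a\<in>D. matches \<kappa> (map_atom id (map_option (subst \<sigma>)) b) a"
      if i: "i < ?n" and b: "b \<in> set (body (\<rho>s' ! i))" for i b
    proof -
      obtain a where "a \<in> D" "matches (\<nu>s i) b a"
        using \<nu>s(2)[OF i] b by (auto simp: sat_def)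
      \<comment> \<open>On the named arguments, \<open>\<sigma>\<close> followed by
        \<open>\<kappa>\<close> is \<open>\<mu>\<close>, which agrees there with
        \<open>\<nu>s i\<close>.\<close>
      moreover have "matches \<kappa> (map_atom id (map_option (subst \<sigma>)) b) a \<longleftrightarrow> matches (\<nu>s i) b a"
        using \<mu>(3)[OF i b] by (intro matches_map_option) (simp add: \<kappa>)
      ultimately show ?thesis by blast
    qed
    moreover have "\<exists>a\<in>D. matches \<kappa> (map_atom id (Some \<circ> subst \<sigma>) b) a"
      if b: "b \<in> set (edb_body P R)" for b
    proof -
      \<comment> \<open>In this form the atom is a lifted one, and matching it means being its
        ground instance.\<close>
      have "map_atom id (Some \<circ> subst \<sigma>) b = map_atom id Some (map_atom id (subst \<sigma>) b)"
        by (simp add: atom.map_comp)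
      moreover have "ground \<kappa> (map_atom id (subst \<sigma>) b) = ground \<nu> b"
        using map_\<kappa>[of "args b"] \<mu>(2)[of b] b by (intro atom.expand) simp
      ultimately show ?thesis using edb[OF b] by auto
    qed
    ultimately show "sat D \<kappa> (unfolded P R \<rho>s' \<sigma>)"
      unfolding sat_def set_unfolded_body using len by (auto simp: in_set_conv_nth[of _ \<rho>s'])
  qed
qed

text \<open>A valuation \<open>\<nu>\<close> of the adorned rule is read as the valuation
  \<open>tval \<nu> \<circ> \<sigma>\<close> of \<open>R\<close>.\<close>

lemma adorned_rule_edb_body:
  assumes out: "adornment_output g h P P'" and len: "length \<rho>s = length (idb_body P R)"
    and M: "\<And>b. b \<in> set (body (adorned_rule P R \<rho>s \<rho> \<sigma>)) \<Longrightarrow>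
      ground \<nu> b \<in> model (lift_rule ` P') (edb_embed D)"
    and b: "b \<in> set (edb_body P R)"
  shows "ground (tval \<nu> \<circ> \<sigma>) b \<in> D"
proof -
  have "ground \<nu> (map_atom Edb (subst \<sigma>) b) \<in> model (lift_rule ` P') (edb_embed D)"
    using b by (intro M) (simp add: set_adorned_rule_body[OF len])
  from output_edb_model[OF out this] have "Atom (pred b) (map (tval (tval \<nu> \<circ> \<sigma>)) (args b)) \<in> D"
    by (simp add: tval_subst comp_def)
  moreover have "ground (tval \<nu> \<circ> \<sigma>) b = Atom (pred b) (map (tval (tval \<nu> \<circ> \<sigma>)) (args b))"
    by (rule atom.expand) simp
  ultimately show ?thesis by simp
qed

section \<open>Boundedness\<close>

text \<open>A single application of \<open>\<rho>\<close> to facts of \<open>D\<close>. Unlike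
  membership in \<open>model {\<rho>} D\<close>, it always supplies a match of the body, which the
  next unfolding needs.\<close>

definition realized :: "('p, 'c) atom set \<Rightarrow> ('p, 'c) wrule \<Rightarrow> 'c list \<Rightarrow> bool" where
  "realized D \<rho> ts \<longleftrightarrow> (\<exists>\<nu>. map (tval \<nu>) (args (head \<rho>)) = ts \<and> sat D \<nu> \<rho>)"

lemma realized_variant: "variant \<rho> \<rho>' \<Longrightarrow> realized D \<rho> ts \<Longrightarrow> realized D \<rho>' ts"
  unfolding realized_def by (metis variant_valuation)

lemma realized_model:
  assumes "realized D \<rho> ts"
  shows "Atom (pred (head \<rho>)) ts \<in> model {\<rho>} D"
proof -
  obtain \<nu> where "map (tval \<nu>) (args (head \<rho>)) = ts" "sat D \<nu> \<rho>"
    using assms by (auto simp: realized_def)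
  moreover then have "ground \<nu> (head \<rho>) = Atom (pred (head \<rho>)) ts" by (intro atom.expand) simp
  ultimately show ?thesis using sat_model by metis
qed

lemma realized_step:
  assumes out: "adornment_output g_out h P P'"
    and choice: "choice P P' R \<rho>s \<rho>s'" and mgu: "mgu \<sigma> (head_eqs P R \<rho>s')"
    and M: "\<And>b. b \<in> set (body (adorned_rule P R \<rho>s \<rho> \<sigma>)) \<Longrightarrow>
      ground \<nu> b \<in> model (lift_rule ` P') (edb_embed D)"
    and IH: "\<And>b \<rho>''. b \<in> set (body (adorned_rule P R \<rho>s \<rho> \<sigma>)) \<Longrightarrow> pred b = adorned \<rho>'' \<Longrightarrow>
      realized D \<rho>'' (map (tval \<nu>) (args b))"
  shows "realized D (g_out (unfolded P R \<rho>s' \<sigma>)) (map (tval \<nu>) (map (subst \<sigma>) (args (head R))))"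
proof -
  have len: "length \<rho>s = length (idb_body P R)" using choice by (simp add: choice_def)
  have idb: "\<exists>\<nu>'. map (tval \<nu>') (args (head (\<rho>s ! i))) = map (tval (tval \<nu> \<circ> \<sigma>)) (args (idb_body P R ! i))
      \<and> sat D \<nu>' (\<rho>s ! i)"
    if "i < length (idb_body P R)" for i
  proof -
    have "realized D (\<rho>s ! i) (map (tval \<nu>) (map (subst \<sigma>) (args (idb_body P R ! i))))"
      using IH[OF adorned_idb_atom[OF len that]] by simp
    then show ?thesis by (simp add: realized_def tval_subst comp_def)
  qed
  have edb: "ground (tval \<nu> \<circ> \<sigma>) b \<in> D" if "b \<in> set (edb_body P R)" for b
    using adorned_rule_edb_body[OF out len M that] .
  obtain \<kappa> where "map (tval \<kappa>) (args (head (unfolded P R \<rho>s' \<sigma>))) = map (tval (tval \<nu> \<circ> \<sigma>)) (args (head R))"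
    "sat D \<kappa> (unfolded P R \<rho>s' \<sigma>)"
    using unfolded_sat[OF choice mgu idb edb] by blast
  then show ?thesis
    unfolding realized_def by (metis (no_types, lifting) g_out_head sat_g_out map_map map_eq_conv comp_apply tval_subst)
qed

text \<open>Boundedness strengthened to an invariant of all derivable adorned facts, so that it is
  available for the body atoms of the topmost rule.\<close>

lemma model_realized:
  assumes "adornment_output g_out h P P'" "a \<in> model (lift_rule ` P') (edb_embed D)"
    "pred a = adorned \<rho>"
  shows "realized D \<rho> (args a)"
  using assms(2,3)
proof (induction arbitrary: \<rho> rule: model_lift_induct)
  case (edb a)
  then show ?case using edb_embed_pred by (fastforce simp: adorned_def)
next
  case (rule Q \<nu>)
  then obtain R \<rho>s \<rho>s' \<sigma> where *: "choice P P' R \<rho>s \<rho>s'" "mgu \<sigma> (head_eqs P R \<rho>s')"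
    and Q: "Q = adorned_rule P R \<rho>s (g_out (unfolded P R \<rho>s' \<sigma>)) \<sigma>"
    using output_candidate[OF assms(1)] unfolding candidate_iff by metis
  have "realized D (g_out (unfolded P R \<rho>s' \<sigma>)) (args (ground \<nu> (head Q)))"
    using realized_step[OF assms(1) *, of "g_out (unfolded P R \<rho>s' \<sigma>)" \<nu> D] rule.hyps(2) rule.IH
    unfolding Q by simp
  \<comment> \<open>The given \<open>\<rho>\<close> has the same predicate as the head of
    \<open>Q\<close>, hence is a variant of the adornment constructed for it.\<close>
  then show ?case using rule.prems realized_variant by (simp add: Q) blast
qed

lemma output_edb_bounded:
  assumes "adornment_output g_out h P P'"
  shows "edb_bounded P P'"
  unfolding edb_bounded_def
proof
  fix Q assume "Q \<in> P'"
  then obtain R \<rho>s \<rho>s' \<sigma> where Q: "Q = adorned_rule P R \<rho>s (g_out (unfolded P R \<rho>s' \<sigma>)) \<sigma>"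
    using output_candidate[OF assms] unfolding candidate_iff by metis
  let ?\<rho> = "g_out (unfolded P R \<rho>s' \<sigma>)"
  have "Atom (pred (head ?\<rho>)) ts \<in> model {?\<rho>} D"
    if ts: "Atom (adorned ?\<rho>) ts \<in> derived_by Q P' (edb_embed D)" for D ts
  proof -
    have "derived_by Q P' (edb_embed D) \<subseteq> model (lift_rule ` P') (edb_embed D)"
      using \<open>Q \<in> P'\<close> by (auto simp: derived_by_lift intro: model_liftI)
    then show ?thesis
      using ts model_realized[OF assms, of "Atom (adorned ?\<rho>) ts"] by (intro realized_model) auto
  qed
  then show "\<exists>\<rho>. pred (head Q) = adorned \<rho> \<and> bounded_by P P' Q \<rho>"
    by (intro exI[of _ ?\<rho>]) (simp add: Q bounded_by_def)
qed

section \<open>Equivalence\<close>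

text \<open>Erasing adornments turns an instance of an adorned rule under \<open>\<nu>\<close> into
  the instance of its source rule \<open>R\<close> under
  \<open>tval \<nu> \<circ> \<sigma>\<close>.\<close>

lemma output_sound:
  assumes "adornment_output g_out h P P'" "a \<in> model (lift_rule ` P') (edb_embed D)"
    "pred a = adorned \<rho>"
  shows "Atom (pred (head \<rho>)) (args a) \<in> model (lift_rule ` P) D"
  using assms(2,3)
proof (induction arbitrary: \<rho> rule: model_lift_induct)
  case (edb a)
  then show ?case using edb_embed_pred by fastforce
next
  case (rule Q \<nu>)
  then obtain R \<rho>s \<rho>s' \<sigma> where R: "R \<in> P" and choice: "choice P P' R \<rho>s \<rho>s'"
    and Q: "Q = adorned_rule P R \<rho>s (g_out (unfolded P R \<rho>s' \<sigma>)) \<sigma>"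
    using output_candidate[OF assms(1)] unfolding candidate_iff by metis
  have len: "length \<rho>s = length (idb_body P R)" using choice by (simp add: choice_def)
  have "ground (tval \<nu> \<circ> \<sigma>) b \<in> model (lift_rule ` P) D" if "b \<in> set (body R)" for b
    using that
  proof (cases rule: body_cases[of _ _ P])
    case (1 i)
    have "Atom (pred (head (\<rho>s ! i))) (map (tval \<nu>) (map (subst \<sigma>) (args b))) \<in> model (lift_rule ` P) D"
      using rule.IH[of "Atom (adorned (\<rho>s ! i)) (map (subst \<sigma>) (args b))" "\<rho>s ! i"]
        adorned_idb_atom[OF len 1(1)] by (simp add: Q 1(2))
    moreover have "pred (head (\<rho>s ! i)) = pred b" using choice 1 by (simp add: choice_def)
    moreover have "ground (tval \<nu> \<circ> \<sigma>) b = Atom (pred b) (map (tval \<nu>) (map (subst \<sigma>) (args b)))"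
      by (rule atom.expand) (simp add: tval_subst)
    ultimately show ?thesis by simp
  next
    case 2
    show ?thesis
      using adorned_rule_edb_body[OF assms(1) len _ 2(1)] rule.hyps(2) unfolding Q
      by (blast intro: model.edb)
  qed
  from model_liftI[OF R this] have "ground (tval \<nu> \<circ> \<sigma>) (head R) \<in> model (lift_rule ` P) D" .
  moreover have "pred (head \<rho>) = pred (head R)"
    using rule.prems variant_pred_head[of _ \<rho>] by (fastforce simp: Q)
  then have "Atom (pred (head \<rho>)) (args (ground \<nu> (head Q))) = ground (tval \<nu> \<circ> \<sigma>) (head R)"
    by (intro atom.expand) (simp add: Q tval_subst)
  ultimately show ?case by simp
qed

text \<open>\<open>h_eq\<close> compares lifted rules; lifting is injective and commutes with
  renaming, so the renaming descends to the rules themselves.\<close>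

lemma variant_lift_rule:
  assumes "variant (lift_rule Q) (lift_rule Q')"
  obtains \<pi> where "head Q' = map_atom id (subst (Var \<circ> \<pi>)) (head Q)"
    "body Q' = map (map_atom id (subst (Var \<circ> \<pi>))) (body Q)"
proof -
  obtain \<pi> where \<pi>: "lift_rule Q' = rename \<pi> (lift_rule Q)"
    using assms by (auto simp: variant_def)
  have "map (map_atom id Some) (body Q') =
      map (map_atom id Some) (map (map_atom id (subst (Var \<circ> \<pi>))) (body Q))"
    using arg_cong[OF \<pi>, of body] by (simp add: atom.map_comp comp_def)
  moreover have "inj (map (map_atom id Some))"
    by (intro list.inj_map atom.inj_map) auto
  ultimately have "body Q' = map (map_atom id (subst (Var \<circ> \<pi>))) (body Q)"
    by (rule injD[rotated])
  moreover have "head Q' = map_atom id (subst (Var \<circ> \<pi>)) (head Q)"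
    using arg_cong[OF \<pi>, of head] by simp
  ultimately show ?thesis using that by blast
qed

text \<open>A rule rejected by \<open>h_eq\<close> costs no derivation: its renamed copy
  \<open>Q\<close> fires under \<open>\<kappa> \<circ> \<pi>\<close>.\<close>

lemma variant_rule_model:
  assumes "Q \<in> P'" "variant (lift_rule Q) (lift_rule Q')"
    and M: "\<And>b. b \<in> set (body Q') \<Longrightarrow> ground \<kappa> b \<in> model (lift_rule ` P') D"
  shows "ground \<kappa> (head Q') \<in> model (lift_rule ` P') D"
proof -
  obtain \<pi> where \<pi>: "head Q' = map_atom id (subst (Var \<circ> \<pi>)) (head Q)"
    "body Q' = map (map_atom id (subst (Var \<circ> \<pi>))) (body Q)"
    using variant_lift_rule[OF assms(2)] .
  have g: "ground \<kappa> (map_atom id (subst (Var \<circ> \<pi>)) b) = ground (\<kappa> \<circ> \<pi>) b" for b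
    by (rule atom.expand) (simp add: tval_subst comp_def)
  have "ground (\<kappa> \<circ> \<pi>) b \<in> model (lift_rule ` P') D" if "b \<in> set (body Q)" for b
    using M[of "map_atom id (subst (Var \<circ> \<pi>)) b"] that by (simp add: \<pi>(2) g)
  from model_liftI[OF assms(1) this] show ?thesis by (simp add: \<pi>(1) g)
qed

lemma output_head:
  assumes "adornment_output g_out h P P'" "Q \<in> P'"
  obtains \<rho> where "head Q = Atom (adorned \<rho>) (args (head \<rho>))"
proof -
  obtain R \<rho>s \<rho>s' \<sigma> where "Q = adorned_rule P R \<rho>s (g_out (unfolded P R \<rho>s' \<sigma>)) \<sigma>"
    using output_candidate[OF assms] unfolding candidate_iff by metis
  then show ?thesis using that[of "g_out (unfolded P R \<rho>s' \<sigma>)"] by simp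
qed

text \<open>Replaces an arbitrary representative \<open>\<rho>'\<close> by one whose head arguments
  are those of a generated rule, as \<open>choice\<close> demands. That rule exists since embedded
  EDB facts are not adorned.\<close>

lemma model_output_head:
  assumes "adornment_output g_out h P P'" "Atom (adorned \<rho>') ts \<in> model (lift_rule ` P') (edb_embed D)"
  obtains \<rho> Q \<nu> where "variant \<rho>' \<rho>" "Q \<in> P'" "head Q = Atom (adorned \<rho>) (args (head \<rho>))"
    "map (tval \<nu>) (args (head \<rho>)) = ts"
  using assms(2)
proof (cases rule: model_lift_cases)
  case 1
  then show ?thesis using edb_embed_pred by fastforce
next
  case (2 Q \<nu>)
  obtain \<rho> where \<rho>: "head Q = Atom (adorned \<rho>) (args (head \<rho>))"
    using output_head[OF assms(1) 2(1)] .
  with 2 have "adorned \<rho>' = adorned \<rho>" "ts = map (tval \<nu>) (args (head \<rho>))"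
    by (auto simp: ground_def)
  then show ?thesis using that[OF _ 2(1) \<rho>, of \<nu>] by simp
qed

lemma output_complete:
  assumes out: "adornment_output g_out h_eq P P'" and D: "edb_instance P D"
    and "a \<in> model (lift_rule ` P) D" "idb P (pred a)"
  shows "\<exists>\<rho>. pred (head \<rho>) = pred a \<and> Atom (adorned \<rho>) (args a) \<in> model (lift_rule ` P') (edb_embed D)"
  using assms(3,4)
proof (induction rule: model_lift_induct)
  case (edb a)
  then show ?case using D by (auto simp: edb_instance_def)
next
  case (rule R \<nu>)
  let ?M = "model (lift_rule ` P') (edb_embed D)"
  let ?n = "length (idb_body P R)"
  have "\<exists>\<rho> \<nu>'. pred (head \<rho>) = pred (idb_body P R ! i) \<and>
      Atom (adorned \<rho>) (map (tval \<nu>) (args (idb_body P R ! i))) \<in> ?M \<and>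
      (\<exists>Q\<in>P'. head Q = Atom (adorned \<rho>) (args (head \<rho>))) \<and>
      map (tval \<nu>') (args (head \<rho>)) = map (tval \<nu>) (args (idb_body P R ! i))" if i: "i < ?n" for i
  proof -
    have b: "idb_body P R ! i \<in> set (body R)" "idb P (pred (idb_body P R ! i))"
      using nth_mem[OF i] by auto
    obtain \<rho>' where \<rho>': "pred (head \<rho>') = pred (idb_body P R ! i)"
      "Atom (adorned \<rho>') (map (tval \<nu>) (args (idb_body P R ! i))) \<in> ?M"
      using rule.IH[OF b(1)] b(2) by auto
    obtain \<rho> Q \<nu>' where "variant \<rho>' \<rho>" "Q \<in> P'" "head Q = Atom (adorned \<rho>) (args (head \<rho>))"
      "map (tval \<nu>') (args (head \<rho>)) = map (tval \<nu>) (args (idb_body P R ! i))"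
      using model_output_head[OF out \<rho>'(2)] .
    moreover then have "pred (head \<rho>) = pred (idb_body P R ! i)" "adorned \<rho> = adorned \<rho>'"
      using variant_pred_head[of \<rho>' \<rho>] \<rho>'(1) by (auto intro: variant_sym)
    ultimately show ?thesis using \<rho>'(2) by metis
  qed
  then obtain \<rho>f \<nu>f where f: "\<And>i. i < ?n \<Longrightarrow> pred (head (\<rho>f i)) = pred (idb_body P R ! i)"
    "\<And>i. i < ?n \<Longrightarrow> Atom (adorned (\<rho>f i)) (map (tval \<nu>) (args (idb_body P R ! i))) \<in> ?M"
    "\<And>i. i < ?n \<Longrightarrow> \<exists>Q\<in>P'. head Q = Atom (adorned (\<rho>f i)) (args (head (\<rho>f i)))"
    "\<And>i. i < ?n \<Longrightarrow> map (tval (\<nu>f i)) (args (head (\<rho>f i))) = map (tval \<nu>) (args (idb_body P R ! i))"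
    by metis
  define \<rho>s where "\<rho>s = map \<rho>f [0..<?n]"
  have len: "length \<rho>s = ?n" by (simp add: \<rho>s_def)
  \<comment> \<open>Renaming apart from \<open>R\<close> and from each other is always possible,
    since rules have finitely many variables.\<close>
  obtain \<rho>s' where len': "length \<rho>s' = ?n" and var: "\<And>i. i < ?n \<Longrightarrow> variant (\<rho>s ! i) (\<rho>s' ! i)"
    and disj: "\<And>i. i < ?n \<Longrightarrow> rule_vars (\<rho>s' ! i) \<inter> rule_vars (lift_rule R) = {}"
      "\<And>i j. i < ?n \<Longrightarrow> j < i \<Longrightarrow> rule_vars (\<rho>s' ! i) \<inter> rule_vars (\<rho>s' ! j) = {}"
    using fresh_variants[OF finite_rule_vars[of "lift_rule R"], of \<rho>s] unfolding len by blast
  have choice: "choice P P' R \<rho>s \<rho>s'"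
    using f var disj len len' by (simp add: choice_def \<rho>s_def)
  have "\<exists>\<nu>'. map (tval \<nu>) (args (idb_body P R ! i)) = map (tval \<nu>') (args (head (\<rho>s' ! i)))"
    if i: "i < ?n" for i
  proof -
    obtain \<nu>' where "map (tval \<nu>') (args (head (\<rho>s' ! i))) = map (tval (\<nu>f i)) (args (head (\<rho>s ! i)))"
      using variant_valuation[OF var[OF i]] by blast
    then show ?thesis using f(4)[OF i] i by (metis (no_types, lifting) \<rho>s_def add_0 diff_zero length_upt nth_map nth_upt)
  qed
  then obtain \<nu>s where \<nu>s:
    "\<And>i. i < ?n \<Longrightarrow> map (tval \<nu>) (args (idb_body P R ! i)) = map (tval (\<nu>s i)) (args (head (\<rho>s' ! i)))"
    by metis
  \<comment> \<open>Only the heads have to agree here; nothing is claimed about satisfaction of the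
    adornment bodies.\<close>
  obtain \<mu> where unif: "unifier (Const \<circ> \<mu>) (head_eqs P R \<rho>s')"
    and \<mu>: "\<And>a. a \<in> insert (head R) (set (body R)) \<Longrightarrow> map (tval \<mu>) (args a) = map (tval \<nu>) (args a)"
    "\<And>i b t. i < ?n \<Longrightarrow> b \<in> set (body (\<rho>s' ! i)) \<Longrightarrow> Some t \<in> set (args b) \<Longrightarrow>
      tval \<mu> t = tval (\<nu>s i) t"
    using ground_unify[OF len' disj \<nu>s] by blast
  obtain \<sigma> where mgu: "mgu \<sigma> (head_eqs P R \<rho>s')"
    using mgu_exists[OF unif] by blast
  obtain \<kappa> where "\<And>t. tval \<kappa> (subst \<sigma> t) = tval \<mu> t"
    using mgu_ground[OF mgu unif] by blast
  then have \<kappa>: "map (tval \<kappa>) (map (subst \<sigma>) (args a)) = map (tval \<nu>) (args a)"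
    if "a \<in> insert (head R) (set (body R))" for a
    using \<mu>(1)[OF that] by simp
  define \<rho> where "\<rho> = g_out (unfolded P R \<rho>s' \<sigma>)"
  define Q' where "Q' = adorned_rule P R \<rho>s \<rho> \<sigma>"
  have "idb P (pred (head R))" using rule.prems by simp
  then have "candidate g_out P P' Q'"
    using rule.hyps(1) choice mgu unfolding candidate_iff Q'_def \<rho>_def by blast
  \<comment> \<open>At the fixpoint no step is enabled, so a candidate can only be blocked by a rule
    identical up to renaming.\<close>
  then have "h_eq Q' P'"
    using out by (auto simp: adornment_output_def adorn_step_def)
  then obtain Q where Q: "Q \<in> P'" "variant (lift_rule Q) (lift_rule Q')"
    by (auto simp: h_eq_def)
  have "ground \<kappa> b \<in> ?M" if b: "b \<in> set (body Q')" for b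
  proof -
    consider i where "i < ?n" "b = Atom (adorned (\<rho>s ! i)) (map (subst \<sigma>) (args (idb_body P R ! i)))"
      | e where "e \<in> set (edb_body P R)" "b = map_atom Edb (subst \<sigma>) e"
      using b unfolding Q'_def set_adorned_rule_body[OF len] by blast
    then show ?thesis
    proof cases
      case 1
      have "idb_body P R ! i \<in> set (body R)" using nth_mem[OF 1(1)] by auto
      then have "ground \<kappa> b = Atom (adorned (\<rho>f i)) (map (tval \<nu>) (args (idb_body P R ! i)))"
        using 1 \<kappa>[of "idb_body P R ! i"] by (intro atom.expand) (simp add: \<rho>s_def)
      then show ?thesis using f(2)[OF 1(1)] by simp
    next
      case 2
      then have e: "e \<in> set (body R)" "\<not> idb P (pred e)" by auto
      have "ground \<nu> e \<in> D"
        using edb_in_instance[OF D rule.hyps(2)[OF e(1)]] e(2) by simp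
      moreover have "ground \<kappa> b = Atom (Edb (pred (ground \<nu> e))) (args (ground \<nu> e))"
        using 2(2) \<kappa>[of e] e(1) by (intro atom.expand) simp
      ultimately show ?thesis using Edb_in_edb_embed by (metis model.edb)
    qed
  qed
  from variant_rule_model[OF Q this] have "ground \<kappa> (head Q') \<in> ?M" .
  moreover have "ground \<kappa> (head Q') = Atom (adorned \<rho>) (args (ground \<nu> (head R)))"
    using \<kappa>[of "head R"] by (intro atom.expand) (simp add: Q'_def)
  ultimately show ?case by (intro exI[of _ \<rho>]) (simp add: \<rho>_def)
qed

section \<open>Well-formedness of the output\<close>

text \<open>A head variable \<open>x\<close> comes from a variable \<open>y\<close> of the head of
  \<open>R\<close> with \<open>\<sigma> y = Var x\<close>, and \<open>y\<close> occurs in the body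
  of \<open>R\<close>. If it occurs in an IDB atom, unification carries \<open>x\<close> into the
  head of the chosen adornment, whose safety carries it on into the body.\<close>

lemma unfolded_safe:
  assumes "choice P P' R \<rho>s \<rho>s'" "unifier \<sigma> (head_eqs P R \<rho>s')" "safe (lift_rule R)"
    and safe: "\<And>i. i < length (idb_body P R) \<Longrightarrow> safe (\<rho>s' ! i)"
  shows "safe (unfolded P R \<rho>s' \<sigma>)"
  unfolding safe_def
proof (intro allI impI)
  let ?U = "unfolded P R \<rho>s' \<sigma>"
  have len: "length \<rho>s' = length (idb_body P R)" using assms(1) by (simp add: choice_def)
  fix x assume "Var x \<in> set (args (head ?U))"
  then obtain y where y: "Var y \<in> set (args (head R))" "\<sigma> y = Var x"
    by (auto dest!: sym[of "Var x"] subst_eq_VarD)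
  then obtain b where "b \<in> set (body R)" and b: "Var y \<in> set (args b)"
    using assms(3) by (auto simp: safe_def)
  from this(1) show "\<exists>b\<in>set (body ?U). Some (Var x) \<in> set (args b)"
  proof (cases rule: body_cases[of _ _ P])
    case (1 i)
    have "Var x \<in> set (map (subst \<sigma>) (args b))" using b y(2) by (force intro: image_eqI[of _ _ "Var y"])
    also have "map (subst \<sigma>) (args b) = map (subst \<sigma>) (args (head (\<rho>s' ! i)))"
      using assms(2) 1 by (simp add: unifier_head_eqs[OF len])
    \<comment> \<open>Substitution fixes constants, so a position holding \<open>Var x\<close>
      afterwards held a variable before.\<close>
    finally obtain z where z: "Var z \<in> set (args (head (\<rho>s' ! i)))" "\<sigma> z = Var x"
      by (auto dest!: sym[of "Var x"] subst_eq_VarD)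
    then obtain c where c: "c \<in> set (body (\<rho>s' ! i))" "Some (Var z) \<in> set (args c)"
      using safe[OF 1(1)] by (auto simp: safe_def)
    have "map_atom id (map_option (subst \<sigma>)) c \<in> set (body ?U)"
      using c(1) 1(1) len by (auto simp: set_unfolded_body)
    moreover have "Some (Var x) \<in> set (args (map_atom id (map_option (subst \<sigma>)) c))"
      using c(2) z(2) by (force intro: image_eqI[of _ _ "Some (Var z)"])
    ultimately show ?thesis by blast
  next
    case 2
    have "map_atom id (Some \<circ> subst \<sigma>) b \<in> set (body ?U)"
      using 2(1) by (auto simp: set_unfolded_body)
    moreover have "Some (Var x) \<in> set (args (map_atom id (Some \<circ> subst \<sigma>) b))"
      using b y(2) by (force intro: image_eqI[of _ _ "Var y"])
    ultimately show ?thesis by blast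
  qed
qed

text \<open>The part of \<open>edb_adorned_atom\<close> that concerns the adornment alone.\<close>

definition edb_adornment :: "('p, 'c) drule set \<Rightarrow> ('p, 'c) wrule \<Rightarrow> bool" where
  "edb_adornment P \<rho> \<longleftrightarrow> idb P (pred (head \<rho>)) \<and> safe \<rho> \<and> (\<forall>b\<in>set (body \<rho>). \<not> idb P (pred b))"

lemma edb_adornment_variant:
  assumes "variant \<rho> \<rho>'" "edb_adornment P \<rho>"
  shows "edb_adornment P \<rho>'"
  using assms variant_pred_head[OF assms(1)] variant_safe[OF assms(1)] variant_body_preds[OF assms(1)]
  unfolding edb_adornment_def by (metis imageE imageI)

lemma edb_adorned_atom_iff:
  "edb_adorned_atom P a \<longleftrightarrow>
    (\<exists>\<rho>. pred a = adorned \<rho> \<and> edb_adornment P \<rho> \<and> (\<exists>\<theta>. args a = map (subst \<theta>) (args (head \<rho>))))"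
  by (auto simp: edb_adorned_atom_def edb_adornment_def)

lemma edb_adornment_unfolded:
  assumes "choice P P' R \<rho>s \<rho>s'" "unifier \<sigma> (head_eqs P R \<rho>s')" "safe (lift_rule R)"
    "idb P (pred (head R))" and \<rho>s': "\<And>i. i < length (idb_body P R) \<Longrightarrow> edb_adornment P (\<rho>s' ! i)"
  shows "edb_adornment P (g_out (unfolded P R \<rho>s' \<sigma>))"
proof -
  have len: "length \<rho>s' = length (idb_body P R)" using assms(1) by (simp add: choice_def)
  have "\<not> idb P (pred b)" if "b \<in> set (body (unfolded P R \<rho>s' \<sigma>))" for b
    using that \<rho>s' len
    by (fastforce simp: set_unfolded_body in_set_conv_nth[of _ \<rho>s'] edb_adornment_def)
  then show ?thesis
    using assms(4) unfolded_safe[OF assms(1-3)] \<rho>s' g_out_safe g_out_body_preds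
    unfolding edb_adornment_def by fastforce
qed

text \<open>Well-formedness of a new adornment rests on that of the chosen ones, hence the induction
  along the run.\<close>

lemma output_edb_adorned_program:
  assumes out: "adornment_output g_out h P P'" and safe: "\<forall>R\<in>P. safe (lift_rule R)"
  shows "edb_adorned_program P P'"
proof -
  have "\<forall>a\<in>insert (head Q) (set (body Q)).
      (\<exists>p. pred a = Edb p \<and> \<not> idb P p) \<or> edb_adorned_atom P a" if "Q \<in> P'" for Q
    using out that
  proof (induction rule: output_induct)
    case (candidate P1 Q)
    obtain R \<rho>s \<rho>s' \<sigma> where R: "R \<in> P" "idb P (pred (head R))" and choice: "choice P P1 R \<rho>s \<rho>s'"
      and mgu: "mgu \<sigma> (head_eqs P R \<rho>s')"
      and Q: "Q = adorned_rule P R \<rho>s (g_out (unfolded P R \<rho>s' \<sigma>)) \<sigma>"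
      using candidate(3) unfolding candidate_iff by blast
    let ?n = "length (idb_body P R)"
    let ?\<rho> = "g_out (unfolded P R \<rho>s' \<sigma>)"
    have unif: "unifier \<sigma> (head_eqs P R \<rho>s')" using mgu by (simp add: mgu_def)
    have len: "length \<rho>s = ?n" "length \<rho>s' = ?n"
      and var: "\<And>i. i < ?n \<Longrightarrow> variant (\<rho>s ! i) (\<rho>s' ! i)"
      using choice by (simp_all add: choice_def)
    have \<rho>s: "edb_adornment P (\<rho>s ! i)" if i: "i < ?n" for i
    proof -
      obtain Q' where "Q' \<in> P1" "head Q' = Atom (adorned (\<rho>s ! i)) (args (head (\<rho>s ! i)))"
        using choice i by (auto simp: choice_def)
      with candidate(1) have "edb_adorned_atom P (Atom (adorned (\<rho>s ! i)) (args (head (\<rho>s ! i))))"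
        by fastforce
      then show ?thesis
        by (auto simp: edb_adorned_atom_iff intro: edb_adornment_variant variant_sym)
    qed
    then have "edb_adornment P ?\<rho>"
      using edb_adornment_unfolded[OF choice unif _ R(2)] safe R(1) var by (blast intro: edb_adornment_variant)
    then have "edb_adorned_atom P (head Q)"
      unfolding edb_adorned_atom_iff
      by (intro exI[of _ ?\<rho>] conjI exI[of _ Var]) (simp_all add: Q subst_Var)
    moreover have "edb_adorned_atom P (Atom (adorned (\<rho>s ! i)) (map (subst \<sigma>) (args (idb_body P R ! i))))"
      if i: "i < ?n" for i
    proof -
      obtain \<theta> where "args (head (\<rho>s' ! i)) = map (subst \<theta>) (args (head (\<rho>s ! i)))"
        using variant_args_head[OF var[OF i]] by blast
      \<comment> \<open>The body atom is an instance of the original adornment head: rename it by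
        \<open>\<theta>\<close>, then apply the unifier.\<close>
      then have "map (subst \<sigma>) (args (idb_body P R ! i)) = map (subst (subst \<sigma> \<circ> \<theta>)) (args (head (\<rho>s ! i)))"
        using unif i by (simp add: unifier_head_eqs[OF len(2)] subst_subst)
      then show ?thesis using \<rho>s[OF i] unfolding edb_adorned_atom_iff atom.sel by blast
    qed
    ultimately show ?case
      unfolding Q set_adorned_rule_body[OF len(1)] by auto
  qed
  then show ?thesis using output_finite[OF out] by (simp add: edb_adorned_program_def)
qed

theorem theorem3p13:
  fixes P :: "('p, 'c) drule set" and P' :: "('p, 'c) arule set"
  assumes "finite P"
    and "adornment_output g_out h_eq P P'"
  shows "((\<forall>R\<in>P. safe (lift_rule R)) \<longrightarrow> edb_adorned_program P P') \<and>
    edb_bounded P P' \<and>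
    (\<forall>D q. edb_instance P D \<longrightarrow> idb P q \<longrightarrow>
       answers P D q = (\<Union>\<rho>\<in>{\<rho>. pred (head \<rho>) = q \<and> adorned \<rho> \<in> preds P'}.
                           answers P' (edb_embed D) (adorned \<rho>)))"
proof (intro conjI impI allI)
  show "edb_adorned_program P P'" if "\<forall>R\<in>P. safe (lift_rule R)"
    using output_edb_adorned_program assms(2) that by blast
  show "edb_bounded P P'" using output_edb_bounded assms(2) by blast
  fix D q assume D: "edb_instance P D" and q: "idb P q"
  show "answers P D q = (\<Union>\<rho>\<in>{\<rho>. pred (head \<rho>) = q \<and> adorned \<rho> \<in> preds P'}.
      answers P' (edb_embed D) (adorned \<rho>))"
  proof (intro set_eqI iffI)
    fix ts assume "ts \<in> answers P D q"
    then obtain \<rho> where \<rho>: "pred (head \<rho>) = q"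
      "Atom (adorned \<rho>) ts \<in> model (lift_rule ` P') (edb_embed D)"
      using output_complete[OF assms(2) D, of "Atom q ts"] q by (auto simp: answers_def)
    obtain \<rho>' Q where "variant \<rho> \<rho>'" "Q \<in> P'" "head Q = Atom (adorned \<rho>') (args (head \<rho>'))"
      using model_output_head[OF assms(2) \<rho>(2)] .
    then have "Q \<in> P'" and Q: "pred (head Q) = adorned \<rho>" by (auto intro: variant_sym)
    \<comment> \<open>\<open>\<rho>\<close> and \<open>\<rho>'\<close> are variants and so name the
      same predicate, the one heading \<open>Q\<close>.\<close>
    then have "adorned \<rho> \<in> preds P'" unfolding preds_def Q[symmetric] by blast
    with \<rho> show "ts \<in> (\<Union>\<rho>\<in>{\<rho>. pred (head \<rho>) = q \<and> adorned \<rho> \<in> preds P'}.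
        answers P' (edb_embed D) (adorned \<rho>))"
      by (auto simp: answers_def)
  next
    fix ts assume "ts \<in> (\<Union>\<rho>\<in>{\<rho>. pred (head \<rho>) = q \<and> adorned \<rho> \<in> preds P'}.
        answers P' (edb_embed D) (adorned \<rho>))"
    then show "ts \<in> answers P D q"
      using output_sound[OF assms(2)] by (fastforce simp: answers_def)
  qed
qed

end
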